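(* Let $(X,d_X)$ and $(Y,d_Y)$ be Polish metric spaces, $\rho_1\in\mathcal{P}(X)$ and $\rho_2\in\mathcal{P}(Y)$ probability measures, $c:X\times Y\to\mathbb{R}$ a bounded Borel cost and $\varepsilon>0$. Let $(a^n)_{n\in\mathbb{N}}$, $(b^n)_{n\in\mathbb{N}}$ be the IPFP (Sinkhorn) sequences. Then there exist a sequence of positive real numbers $(\lambda_n)_{n\in\mathbb{N}}$ and functions $a,b$ solving the Schrödinger system such that, for every $1\le p<+\infty$, $$a^n/\lambda_n\to a\ \text{ in } L^p(\rho_1)\quad\text{and}\quad \lambda_n b^n\to b\ \text{ in } L^p(\rho_2).$$ In particular, the sequence $\gamma^n=a^n(x)b^n(y)k(x,y)$ converges in $L^p(\rho_1\otimes\rho_2)$, for every $1\le p<+\infty$, to the density with respect to $\rho_1\otimes\rho_2$ of the minimizer $\gamma^{\varepsilon}_{opt}$ of the Schrödinger problem $\inf_{\gamma\in\Pi(\rho_1,\rho_2)}\varepsilon\,\mathrm{KL}(\gamma|\mathcal{K})$.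
   Context: $k(x,y)=e^{-c(x,y)/\varepsilon}$ and $\mathcal{K}=k\,\rho_1\otimes\rho_2$ is the Gibbs kernel. $\Pi(\rho_1,\rho_2)$ is the set of probability measures on $X\times Y$ with marginals $\rho_1$ and $\rho_2$. $\mathrm{KL}(\gamma|\mathcal{K})=\int \gamma\log(\gamma/k)\,d(\rho_1\otimes\rho_2)$ if $\gamma\ll\rho_1\otimes\rho_2$ (where $\gamma$ also denotes its density with respect to $\rho_1\otimes\rho_2$), and $+\infty$ otherwise. The Schrödinger problem has a unique minimizer $\gamma^\varepsilon_{opt}$. IPFP sequences: $a^0\equiv1$, $b^0\equiv 1$ and for $n\ge1$ $$b^n(y)=\frac{1}{\int_X k(x,y)a^{n-1}(x)\,d\rho_1(x)},\qquad a^n(x)=\frac{1}{\int_Y k(x,y)b^{n}(y)\,d\rho_2(y)}.$$ Schrödinger system: nonnegative measurable functions $a$ on $X$, $b$ on $Y$ solve it if $a(x)\int_Y b(y)k(x,y)\,d\rho_2(y)=1$ for $\rho_1$-a.e. $x$ and $b(y)\int_X a(x)k(x,y)\,d\rho_1(x)=1$ for $\rho_2$-a.e. $y$. *)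

theory Defs
  imports "HOL-Probability.Probability"
begin

definition gibbs_kernel :: "('a \<times> 'b \<Rightarrow> real) \<Rightarrow> real \<Rightarrow> 'a \<times> 'b \<Rightarrow> real" where
  "gibbs_kernel c \<epsilon> z = exp (- c z / \<epsilon>)"

fun ipfp_a :: "('a \<times> 'b \<Rightarrow> real) \<Rightarrow> real \<Rightarrow> 'a measure \<Rightarrow> 'b measure \<Rightarrow> nat \<Rightarrow> 'a \<Rightarrow> real"
  and ipfp_b :: "('a \<times> 'b \<Rightarrow> real) \<Rightarrow> real \<Rightarrow> 'a measure \<Rightarrow> 'b measure \<Rightarrow> nat \<Rightarrow> 'b \<Rightarrow> real"
where
  "ipfp_a c \<epsilon> \<rho>1 \<rho>2 0 x = 1"
| "ipfp_a c \<epsilon> \<rho>1 \<rho>2 (Suc n) x =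
     1 / (\<integral>y. gibbs_kernel c \<epsilon> (x, y) * ipfp_b c \<epsilon> \<rho>1 \<rho>2 (Suc n) y \<partial>\<rho>2)"
| "ipfp_b c \<epsilon> \<rho>1 \<rho>2 0 y = 1"
| "ipfp_b c \<epsilon> \<rho>1 \<rho>2 (Suc n) y =
     1 / (\<integral>x. gibbs_kernel c \<epsilon> (x, y) * ipfp_a c \<epsilon> \<rho>1 \<rho>2 n x \<partial>\<rho>1)"

(* The Bochner integral of a non-integrable function is 0, so each equation also
   forces the nonnegative integral occurring in it to be finite. *)
definition solves_schrodinger_system ::
  "('a::topological_space \<times> 'b::topological_space \<Rightarrow> real) \<Rightarrow> real \<Rightarrow> 'a measure \<Rightarrow> 'b measure
     \<Rightarrow> ('a \<Rightarrow> real) \<Rightarrow> ('b \<Rightarrow> real) \<Rightarrow> bool" where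
  "solves_schrodinger_system c \<epsilon> \<rho>1 \<rho>2 a b \<longleftrightarrow>
     a \<in> borel_measurable borel \<and> (\<forall>x. 0 \<le> a x) \<and>
     b \<in> borel_measurable borel \<and> (\<forall>y. 0 \<le> b y) \<and>
     (AE x in \<rho>1. a x * (\<integral>y. b y * gibbs_kernel c \<epsilon> (x, y) \<partial>\<rho>2) = 1) \<and>
     (AE y in \<rho>2. b y * (\<integral>x. a x * gibbs_kernel c \<epsilon> (x, y) \<partial>\<rho>1) = 1)"

definition couplings ::
  "'a::topological_space measure \<Rightarrow> 'b::topological_space measure \<Rightarrow> ('a \<times> 'b) measure set" where
  "couplings \<rho>1 \<rho>2 =
     {\<gamma>. prob_space \<gamma> \<and> sets \<gamma> = sets borel \<and> distr \<gamma> borel fst = \<rho>1 \<and> distr \<gamma> borel snd = \<rho>2}"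

(* Lebesgue integral with values in the extended reals, so that a function whose positive part
   has infinite integral is integrated to infinity and not to 0. The value is the intended one
   as soon as one of the two parts has finite integral; infinity - infinity is infinity in ereal. *)
definition ext_integral :: "'a measure \<Rightarrow> ('a \<Rightarrow> real) \<Rightarrow> ereal" where
  "ext_integral M f =
     enn2ereal (\<integral>\<^sup>+ x. ennreal (f x) \<partial>M) - enn2ereal (\<integral>\<^sup>+ x. ennreal (- f x) \<partial>M)"

definition coupling_density ::
  "'a measure \<Rightarrow> 'b measure \<Rightarrow> ('a \<times> 'b) measure \<Rightarrow> 'a \<times> 'b \<Rightarrow> real" where
  "coupling_density \<rho>1 \<rho>2 \<gamma> z = enn2real (RN_deriv (\<rho>1 \<Otimes>\<^sub>M \<rho>2) \<gamma> z)"

(* KL (gamma | K) for the Gibbs measure K = k (rho1 x rho2). The library's KL_divergence is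
   real-valued, hence unsuitable: it is not infinite for singular or infinite-entropy measures.
   The convention 0 log 0 = 0 holds because the logarithm is multiplied by the density. *)
definition KL_gibbs ::
  "('a \<times> 'b \<Rightarrow> real) \<Rightarrow> real \<Rightarrow> 'a measure \<Rightarrow> 'b measure \<Rightarrow> ('a \<times> 'b) measure \<Rightarrow> ereal" where
  "KL_gibbs c \<epsilon> \<rho>1 \<rho>2 \<gamma> =
     (if absolutely_continuous (\<rho>1 \<Otimes>\<^sub>M \<rho>2) \<gamma>
      then ext_integral (\<rho>1 \<Otimes>\<^sub>M \<rho>2)
             (\<lambda>z. coupling_density \<rho>1 \<rho>2 \<gamma> z *
                  ln (coupling_density \<rho>1 \<rho>2 \<gamma> z / gibbs_kernel c \<epsilon> z))
      else \<infinity>)"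

definition schrodinger_minimizer ::
  "('a::topological_space \<times> 'b::topological_space \<Rightarrow> real) \<Rightarrow> real \<Rightarrow> 'a measure \<Rightarrow> 'b measure
     \<Rightarrow> ('a \<times> 'b) measure \<Rightarrow> bool" where
  "schrodinger_minimizer c \<epsilon> \<rho>1 \<rho>2 \<gamma> \<longleftrightarrow>
     is_arg_min (\<lambda>\<gamma>. ereal \<epsilon> * KL_gibbs c \<epsilon> \<rho>1 \<rho>2 \<gamma>) (\<lambda>\<gamma>. \<gamma> \<in> couplings \<rho>1 \<rho>2) \<gamma>"

definition schrodinger_opt ::
  "('a::topological_space \<times> 'b::topological_space \<Rightarrow> real) \<Rightarrow> real \<Rightarrow> 'a measure \<Rightarrow> 'b measure
     \<Rightarrow> ('a \<times> 'b) measure" where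
  "schrodinger_opt c \<epsilon> \<rho>1 \<rho>2 = (THE \<gamma>. schrodinger_minimizer c \<epsilon> \<rho>1 \<rho>2 \<gamma>)"

definition in_Lp :: "real \<Rightarrow> 'a measure \<Rightarrow> ('a \<Rightarrow> real) \<Rightarrow> bool" where
  "in_Lp p M f \<longleftrightarrow> f \<in> borel_measurable M \<and> integrable M (\<lambda>x. \<bar>f x\<bar> powr p)"

definition Lp_norm :: "real \<Rightarrow> 'a measure \<Rightarrow> ('a \<Rightarrow> real) \<Rightarrow> real" where
  "Lp_norm p M f = (\<integral>x. \<bar>f x\<bar> powr p \<partial>M) powr (1 / p)"

definition tendsto_Lp :: "real \<Rightarrow> 'a measure \<Rightarrow> (nat \<Rightarrow> 'a \<Rightarrow> real) \<Rightarrow> ('a \<Rightarrow> real) \<Rightarrow> bool" where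
  "tendsto_Lp p M F f \<longleftrightarrow>
     (\<forall>n. in_Lp p M (F n)) \<and> in_Lp p M f \<and> (\<lambda>n. Lp_norm p M (\<lambda>x. F n x - f x)) \<longlonglongrightarrow> 0"

end

theory Submission
  imports Defs
begin

text \<open>
  Since \<open>c\<close> is bounded, the kernel takes values in some \<open>[m, K]\<close> with \<open>m > 0\<close>. The ratio of consecutive
  iterates \<open>a\<^sup>n\<^sup>+\<^sup>1 / a\<^sup>n\<close> arises from the previous one by averaging against probability kernels, which shrinks
  its oscillation by the factor \<open>1 - (m / K)\<^sup>2\<close> while keeping it in a decreasing sequence of intervals;
  mass conservation puts 1 into each of these. Hence \<open>ln a\<^sup>n\<close> is uniformly Cauchy at a geometric rate,
  no renormalisation is needed (\<open>\<lambda>\<^sub>n = 1\<close>), and \<open>L\<^sup>p\<close> convergence follows by dominated convergence.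
  For the limits \<open>a, b\<close> and \<open>g = a b k\<close>, the entropy of a coupling with density \<open>f\<close> is
  the integral of the nonnegative function \<open>f ln (f / g) - f + g\<close> plus a constant depending only on
  the marginals, so \<open>g\<close> is the density of the unique minimizer.
\<close>

section \<open>Averages against a kernel bounded away from zero\<close>

text \<open>The bounds hold at every point, not just almost everywhere, so ratios of two such
  functions can be compared over all points.\<close>

definition bounded_positive :: "'a measure \<Rightarrow> ('a \<Rightarrow> real) \<Rightarrow> bool" where
  "bounded_positive M f \<longleftrightarrow>
     f \<in> borel_measurable M \<and> (\<exists>l>0. \<exists>u. \<forall>x. l \<le> f x \<and> f x \<le> u)"

text \<open>A half step of the Sinkhorn iteration; the kernel takes the free variable first and the
  integrated one second.\<close>

definition kernel_recip :: "'a measure \<Rightarrow> ('b \<Rightarrow> 'a \<Rightarrow> real) \<Rightarrow> ('a \<Rightarrow> real) \<Rightarrow> 'b \<Rightarrow> real" where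
  "kernel_recip M w f y = 1 / (\<integral>x. w y x * f x \<partial>M)"

text \<open>It is left open which of the two variables is integrated, so that each estimate serves
  both half steps.\<close>

locale positive_kernel = prob_space M for M :: "'a measure" +
  fixes w :: "'b \<Rightarrow> 'a \<Rightarrow> real" and m K :: real
  assumes kernel_measurable [measurable]: "\<And>y. w y \<in> borel_measurable M"
    and m_pos: "0 < m" and kernel_ge: "\<And>y x. m \<le> w y x" and kernel_le: "\<And>y x. w y x \<le> K"
begin

lemma kernel_pos: "0 < w y x"
  using kernel_ge m_pos less_le_trans by blast

lemma K_pos: "0 < K"
  using kernel_pos kernel_le less_le_trans by blast

lemma m_le_K: "m \<le> K"
  using kernel_ge kernel_le order_trans by blast

lemma integrable_kernel:
  assumes [measurable]: "f \<in> borel_measurable M" and f: "\<And>x. \<bar>f x\<bar> \<le> u"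
  shows "integrable M (\<lambda>x. w y x * f x)"
proof (rule integrable_const_bound[where B = "K * u"])
  have "\<bar>w y x * f x\<bar> \<le> K * u" for x
    unfolding abs_mult using kernel_pos[of y x] kernel_le[of y x] f[of x] K_pos
    by (intro mult_mono) auto
  then show "AE x in M. norm (w y x * f x) \<le> K * u" by simp
qed measurable

lemma integrable_kernel_positive:
  assumes "bounded_positive M f"
  shows "integrable M (\<lambda>x. w y x * f x)"
proof -
  obtain l u where "0 < l" and lu: "\<And>x. l \<le> f x \<and> f x \<le> u" and "f \<in> borel_measurable M"
    using assms unfolding bounded_positive_def by blast
  moreover have "\<bar>f x\<bar> \<le> u" for x
    using lu[of x] \<open>0 < l\<close> by linarith
  ultimately show ?thesis using integrable_kernel by blast
qed

lemma kernel_integral_bounds: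
  assumes [measurable]: "f \<in> borel_measurable M" and l: "0 < l" and f: "\<And>x. l \<le> f x \<and> f x \<le> u"
  shows "m * l \<le> (\<integral>x. w y x * f x \<partial>M)" and "(\<integral>x. w y x * f x \<partial>M) \<le> K * u"
proof -
  have bp: "bounded_positive M f"
    unfolding bounded_positive_def using assms by blast
  note int = integrable_kernel_positive[OF bp, of y]
  have u: "0 < f x" "f x \<le> u" for x using f[of x] l by auto
  have "m * l \<le> w y x * f x" for x
    using kernel_ge[of y x] f[of x] l m_pos by (intro mult_mono) auto
  from integral_mono[OF _ int this] show "m * l \<le> (\<integral>x. w y x * f x \<partial>M)"
    by (simp add: prob_space)
  have "w y x * f x \<le> K * u" for x
    using kernel_le[of y x] u[of x] K_pos by (intro mult_mono) auto
  from integral_mono[OF int _ this] show "(\<integral>x. w y x * f x \<partial>M) \<le> K * u"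
    by (simp add: prob_space)
qed

lemma kernel_integral_pos:
  assumes "bounded_positive M f"
  shows "0 < (\<integral>x. w y x * f x \<partial>M)"
proof -
  obtain l u where l: "0 < l" and lu: "\<And>x. l \<le> f x \<and> f x \<le> u" and "f \<in> borel_measurable M"
    using assms unfolding bounded_positive_def by blast
  then have "m * l \<le> (\<integral>x. w y x * f x \<partial>M)" using kernel_integral_bounds(1) by blast
  then show ?thesis using l m_pos by (meson less_le_trans mult_pos_pos)
qed

lemma kernel_recip_bounds:
  assumes "f \<in> borel_measurable M" "0 < l" "\<And>x. l \<le> f x \<and> f x \<le> u"
  shows "1 / (K * u) \<le> kernel_recip M w f y" and "kernel_recip M w f y \<le> 1 / (m * l)"
proof -
  \<comment> \<open>Evaluating the bounds at an arbitrary point gives l \<le> u, hence 0 <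
    u.\<close>
  have "0 < m * l" "0 < K" "0 < u" using assms(2) assms(3)[of undefined] m_pos K_pos by auto
  with kernel_integral_bounds[OF assms, of y]
  show "1 / (K * u) \<le> kernel_recip M w f y" "kernel_recip M w f y \<le> 1 / (m * l)"
    unfolding kernel_recip_def by (auto intro!: divide_left_mono mult_pos_pos)
qed

text \<open>Dominated convergence with the constant \<open>K * u\<close>; the common lower bound
  \<open>l\<close> keeps the limit integral positive, so taking reciprocals is continuous
  there.\<close>

lemma kernel_recip_tendsto:
  assumes [measurable]: "\<And>n. F n \<in> borel_measurable M" and l: "0 < l"
    and F: "\<And>n x. l \<le> F n x \<and> F n x \<le> u" and lim: "\<And>x. (\<lambda>n. F n x) \<longlonglongrightarrow> f x"
  shows "(\<lambda>n. kernel_recip M w (F n) y) \<longlonglongrightarrow> kernel_recip M w f y"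
proof -
  have f_measurable [measurable]: "f \<in> borel_measurable M"
    by (rule borel_measurable_LIMSEQ_real[OF lim]) measurable
  have "l \<le> f x \<and> f x \<le> u" for x
    using LIMSEQ_le_const[OF lim[of x], of l] LIMSEQ_le_const2[OF lim[of x], of u] F by auto
  then have f: "bounded_positive M f"
    unfolding bounded_positive_def using l f_measurable by blast
  have "(\<lambda>n. \<integral>x. w y x * F n x \<partial>M) \<longlonglongrightarrow> (\<integral>x. w y x * f x \<partial>M)"
  proof (rule integral_dominated_convergence[where w = "\<lambda>_. K * u"])
    show "AE x in M. (\<lambda>n. w y x * F n x) \<longlonglongrightarrow> w y x * f x"
      by (intro AE_I2 tendsto_mult tendsto_const lim)
    have "\<bar>w y x * F n x\<bar> \<le> K * u" for x n
      unfolding abs_mult using kernel_pos[of y x] kernel_le[of y x] F[of n x] K_pos l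
      by (intro mult_mono) auto
    then show "AE x in M. norm (w y x * F n x) \<le> K * u" for n by simp
  qed auto
  then show ?thesis
    unfolding kernel_recip_def using kernel_integral_pos[OF f, of y]
    by (intro tendsto_divide tendsto_const) auto
qed

section \<open>Propagation of ratio bounds through averages and reciprocals\<close>

lemma kernel_integral_ratio:
  assumes f: "bounded_positive M f" and g: "bounded_positive M g"
    and fg: "\<And>x. \<alpha> * f x \<le> g x \<and> g x \<le> \<beta> * f x"
  shows "\<alpha> * (\<integral>x. w y x * f x \<partial>M) \<le> (\<integral>x. w y x * g x \<partial>M)"
    and "(\<integral>x. w y x * g x \<partial>M) \<le> \<beta> * (\<integral>x. w y x * f x \<partial>M)"
proof -
  note int = integrable_kernel_positive[OF f, of y] integrable_kernel_positive[OF g, of y]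
  have "\<alpha> * (w y x * f x) \<le> w y x * g x" "w y x * g x \<le> \<beta> * (w y x * f x)" for x
    using mult_left_mono[OF conjunct1[OF fg[of x]], of "w y x"]
      mult_left_mono[OF conjunct2[OF fg[of x]], of "w y x"] kernel_pos[of y x]
    by (simp_all only: mult.left_commute less_imp_le)
  then show "\<alpha> * (\<integral>x. w y x * f x \<partial>M) \<le> (\<integral>x. w y x * g x \<partial>M)"
    and "(\<integral>x. w y x * g x \<partial>M) \<le> \<beta> * (\<integral>x. w y x * f x \<partial>M)"
    using integral_mono[OF integrable_mult_right[OF int(1), of \<alpha>] int(2)]
      integral_mono[OF int(2) integrable_mult_right[OF int(1), of \<beta>]] int by auto
qed

text \<open>Reciprocals swap and invert the two bounds, so two half steps restore their
  orientation.\<close>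

lemma kernel_recip_ratio:
  assumes f: "bounded_positive M f" and g: "bounded_positive M g" and "0 < \<alpha>"
    and fg: "\<alpha> * (\<integral>x. w y x * f x \<partial>M) \<le> (\<integral>x. w y x * g x \<partial>M)"
      "(\<integral>x. w y x * g x \<partial>M) \<le> \<beta> * (\<integral>x. w y x * f x \<partial>M)"
  shows "1 / \<beta> * kernel_recip M w f y \<le> kernel_recip M w g y"
    and "kernel_recip M w g y \<le> 1 / \<alpha> * kernel_recip M w f y"
proof -
  note pos = kernel_integral_pos[OF f, of y] kernel_integral_pos[OF g, of y]
  show "1 / \<beta> * kernel_recip M w f y \<le> kernel_recip M w g y"
    using frac_le[of 1 1, OF _ _ pos(2) fg(2)] unfolding kernel_recip_def by simp
  have "0 < \<alpha> * (\<integral>x. w y x * f x \<partial>M)" using pos \<open>0 < \<alpha>\<close> by simp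
  from frac_le[of 1 1, OF _ _ this fg(1)]
  show "kernel_recip M w g y \<le> 1 / \<alpha> * kernel_recip M w f y"
    unfolding kernel_recip_def by simp
qed

text \<open>For any two points the probability weights \<open>w y x * f x\<close> (normalised) dominate each other
  up to the factor \<open>(m / K)\<^sup>2\<close>, hence averaging the ratio \<open>g / f\<close> contracts its oscillation.\<close>

lemma kernel_average_oscillation:
  assumes f: "bounded_positive M f" and g: "bounded_positive M g"
    and fg: "\<And>x. \<alpha> * f x \<le> g x \<and> g x \<le> \<beta> * f x"
  shows "(\<integral>x. w y' x * g x \<partial>M) / (\<integral>x. w y' x * f x \<partial>M)
          - (\<integral>x. w y x * g x \<partial>M) / (\<integral>x. w y x * f x \<partial>M) \<le> (1 - (m / K)\<^sup>2) * (\<beta> - \<alpha>)"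
proof -
  define I where "I = (\<lambda>f y. \<integral>x. w y x * f x \<partial>M)"
  \<comment> \<open>Subtracting the lower bound leaves a nonnegative function, to which the
    comparison of kernels applies; its average relative to \<open>f\<close> is that of
    \<open>g\<close> minus \<alpha>.\<close>
  define h where "h = (\<lambda>x. g x - \<alpha> * f x)"
  define q where "q = m / K"
  have q: "0 < q" "q \<le> 1" using m_pos K_pos m_le_K by (auto simp: q_def)
  have w: "q * w y x \<le> w y' x" for x y y'
  proof -
    have "q * w y x \<le> q * K" using kernel_le q by (intro mult_left_mono) auto
    also have "\<dots> = m" using K_pos by (simp add: q_def)
    finally show ?thesis using kernel_ge[of y' x] by simp
  qed
  note intf = integrable_kernel_positive[OF f] and intg = integrable_kernel_positive[OF g]
  have split: "w y x * h x = w y x * g x - \<alpha> * (w y x * f x)" for x y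
    by (simp add: h_def algebra_simps)
  have inth: "integrable M (\<lambda>x. w y x * h x)" for y
    unfolding split using intf[of y] intg[of y] by simp
  have Ih: "I h y = I g y - \<alpha> * I f y" for y
    unfolding I_def split using intf[of y] intg[of y] by simp
  have fpos: "0 \<le> f x" for x
    using f unfolding bounded_positive_def by (meson less_imp_le order_trans)
  have hpos: "0 \<le> h x" for x using fg by (simp add: h_def)
  have cmp: "q * I p y \<le> I p y'" if "\<And>x. 0 \<le> p x" "\<And>y. integrable M (\<lambda>x. w y x * p x)" for p y y'
  proof -
    have "q * (w y x * p x) \<le> w y' x * p x" for x
      using mult_right_mono[OF w[of y x y'] that(1)[of x]] by (simp add: mult.assoc)
    from integral_mono[OF integrable_mult_right[OF that(2), of q] that(2) this]
    show ?thesis unfolding I_def by simp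
  qed
  have Ifpos: "0 < I f y" for y unfolding I_def by (rule kernel_integral_pos[OF f])
  have Ihpos: "0 \<le> I h y" for y
    unfolding I_def using hpos kernel_pos by (auto intro!: Bochner_Integration.integral_nonneg simp: less_imp_le)
  \<comment> \<open>One factor \<open>q\<close> comes from comparing the numerators at
    \<open>y'\<close> and \<open>y\<close>, the other from comparing the denominators.\<close>
  have "q\<^sup>2 * (I h y' / I f y') \<le> I h y / I f y"
  proof -
    have "(q * I h y') * (q * I f y) \<le> I h y * I f y'"
      by (intro mult_mono cmp) (use fpos hpos inth intf Ihpos Ifpos q in \<open>auto simp: less_imp_le\<close>)
    then show ?thesis using Ifpos[of y] Ifpos[of y'] by (simp add: field_simps power2_eq_square)
  qed
  moreover have R: "I h y / I f y = I g y / I f y - \<alpha>" for y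
    using Ifpos[of y] by (simp add: Ih diff_divide_distrib)
  \<comment> \<open>With S the relative average of \<open>h\<close>, S(y') - S(y) \<le> (1 - q^2)
    S(y') \<le> (1 - q^2) (\<beta> - \<alpha>), and \<alpha> cancels in the difference on the
    left.\<close>
  moreover have "I h y' / I f y' \<le> \<beta> - \<alpha>"
    using kernel_integral_ratio(2)[OF f g fg, of y'] Ifpos[of y']
    unfolding R by (simp add: pos_divide_le_eq I_def)
  then have "(1 - q\<^sup>2) * (I h y' / I f y') \<le> (1 - q\<^sup>2) * (\<beta> - \<alpha>)"
    using q by (intro mult_left_mono) (auto simp: power_le_one)
  moreover have "(1 - q\<^sup>2) * (I h y' / I f y') = I h y' / I f y' - q\<^sup>2 * (I h y' / I f y')"
    by (simp only: left_diff_distrib mult_1)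
  ultimately have "I g y' / I f y' - I g y / I f y \<le> (1 - q\<^sup>2) * (\<beta> - \<alpha>)"
    using R[of y] R[of y'] by linarith
  then show ?thesis unfolding I_def q_def .
qed

text \<open>\<open>lo\<close> and \<open>hi\<close> are the infimum and supremum over all
  \<open>y\<close> of the averaged ratio; the bound on its difference at two points passes to
  \<open>hi - lo\<close>.\<close>

lemma kernel_average_contraction:
  assumes f: "bounded_positive M f" and g: "bounded_positive M g"
    and fg: "\<And>x. \<alpha> * f x \<le> g x \<and> g x \<le> \<beta> * f x"
  shows "\<exists>lo hi. \<alpha> \<le> lo \<and> lo \<le> hi \<and> hi - lo \<le> (1 - (m / K)\<^sup>2) * (\<beta> - \<alpha>) \<and>
    (\<forall>y. lo * (\<integral>x. w y x * f x \<partial>M) \<le> (\<integral>x. w y x * g x \<partial>M) \<and>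
         (\<integral>x. w y x * g x \<partial>M) \<le> hi * (\<integral>x. w y x * f x \<partial>M))"
proof -
  define R where "R y = (\<integral>x. w y x * g x \<partial>M) / (\<integral>x. w y x * f x \<partial>M)" for y
  have R: "\<alpha> \<le> R y" "R y \<le> \<beta>" for y
    using kernel_integral_ratio[OF f g fg, of y] kernel_integral_pos[OF f, of y]
    by (auto simp: R_def pos_divide_le_eq pos_le_divide_eq)
  have bdd: "bdd_above (range R)" "bdd_below (range R)"
    using R by (auto simp: bdd_above_def bdd_below_def)
  have R': "(INF y. R y) \<le> R y" "R y \<le> (SUP y. R y)" for y
    using bdd by (auto intro: cINF_lower cSUP_upper)
  have osc: "R y' \<le> R y + (1 - (m / K)\<^sup>2) * (\<beta> - \<alpha>)" for y y'
    using kernel_average_oscillation[OF f g fg, of y' y] by (simp add: R_def)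
  \<comment> \<open>The supremum is taken over one point of the pair with the other fixed; the
    infimum over the other follows.\<close>
  have "(SUP y. R y) - (1 - (m / K)\<^sup>2) * (\<beta> - \<alpha>) \<le> R y" for y
    using cSUP_least[of UNIV R "R y + (1 - (m / K)\<^sup>2) * (\<beta> - \<alpha>)"] osc by (simp add: diff_le_eq)
  then have "(SUP y. R y) - (1 - (m / K)\<^sup>2) * (\<beta> - \<alpha>) \<le> (INF y. R y)"
    by (intro cINF_greatest) auto
  moreover have "\<alpha> \<le> (INF y. R y)"
    using R by (auto intro: cINF_greatest)
  moreover have "(INF y. R y) \<le> (SUP y. R y)"
    using R' order_trans by blast
  moreover have "(INF y. R y) * (\<integral>x. w y x * f x \<partial>M) \<le> (\<integral>x. w y x * g x \<partial>M) \<and>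
         (\<integral>x. w y x * g x \<partial>M) \<le> (SUP y. R y) * (\<integral>x. w y x * f x \<partial>M)" for y
    using R'[of y] kernel_integral_pos[OF f, of y]
    by (simp add: R_def[of y] pos_divide_le_eq pos_le_divide_eq)
  ultimately show ?thesis
    by (intro exI[of _ "INF y. R y"] exI[of _ "SUP y. R y"]) (auto simp: algebra_simps)
qed

end

section \<open>Convergence of the Sinkhorn iteration\<close>

text \<open>Full spaces make every section of \<open>k\<close> measurable, as
  \<open>positive_kernel\<close> demands.\<close>

locale sinkhorn = M1: prob_space M1 + M2: prob_space M2
  for M1 :: "'a measure" and M2 :: "'b measure" +
  fixes k :: "'a \<times> 'b \<Rightarrow> real" and m K :: real
  assumes space1: "space M1 = UNIV" and space2: "space M2 = UNIV"
    and k_measurable [measurable]: "k \<in> borel_measurable (M1 \<Otimes>\<^sub>M M2)"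
    and m_pos: "0 < m" and k_ge: "\<And>z. m \<le> k z" and k_le: "\<And>z. k z \<le> K"
begin

sublocale pair_prob_space M1 M2 ..

text \<open>\<open>K1\<close> integrates over the first factor and serves the update of b;
  \<open>K2\<close> below integrates over the second and serves the update of a.\<close>

sublocale K1: positive_kernel M1 "\<lambda>y x. k (x, y)" m K
proof
  show "(\<lambda>x. k (x, y)) \<in> borel_measurable M1" for y
    using measurable_compose[OF measurable_Pair2' k_measurable] space2 by auto
qed (use m_pos k_ge k_le in auto)

sublocale K2: positive_kernel M2 "\<lambda>x y. k (x, y)" m K
proof
  show "(\<lambda>y. k (x, y)) \<in> borel_measurable M2" for x
    using measurable_compose[OF measurable_Pair1' k_measurable] space1 by auto
qed (use m_pos k_ge k_le in auto)

abbreviation recip1 where "recip1 \<equiv> kernel_recip M1 (\<lambda>y x. k (x, y))"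
abbreviation recip2 where "recip2 \<equiv> kernel_recip M2 (\<lambda>x y. k (x, y))"

lemma recip1_measurable [measurable]:
  assumes [measurable]: "f \<in> borel_measurable M1"
  shows "recip1 f \<in> borel_measurable M2"
  unfolding kernel_recip_def by measurable

lemma recip2_measurable [measurable]:
  assumes [measurable]: "f \<in> borel_measurable M2"
  shows "recip2 f \<in> borel_measurable M1"
  unfolding kernel_recip_def by measurable

lemma recip1_positive:
  assumes "bounded_positive M1 f"
  shows "bounded_positive M2 (recip1 f)"
proof -
  obtain l u where *: "f \<in> borel_measurable M1" "0 < l" "\<And>x. l \<le> f x \<and> f x \<le> u"
    using assms unfolding bounded_positive_def by blast
  have "0 < 1 / (K * u)" using *(2) *(3)[of undefined] K1.K_pos by simp
  then show ?thesis
    unfolding bounded_positive_def using K1.kernel_recip_bounds[OF *] recip1_measurable *(1) by blast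
qed

lemma recip2_positive:
  assumes "bounded_positive M2 f"
  shows "bounded_positive M1 (recip2 f)"
proof -
  obtain l u where *: "f \<in> borel_measurable M2" "0 < l" "\<And>x. l \<le> f x \<and> f x \<le> u"
    using assms unfolding bounded_positive_def by blast
  have "0 < 1 / (K * u)" using *(2) *(3)[of undefined] K1.K_pos by simp
  then show ?thesis
    unfolding bounded_positive_def using K2.kernel_recip_bounds[OF *] recip2_measurable *(1) by blast
qed

text \<open>A full round, from a^n through b^(n+1) to a^(n+1).\<close>

definition sinkhorn_step :: "('a \<Rightarrow> real) \<Rightarrow> 'a \<Rightarrow> real" where
  "sinkhorn_step f = recip2 (recip1 f)"

lemma sinkhorn_step_positive: "bounded_positive M1 f \<Longrightarrow> bounded_positive M1 (sinkhorn_step f)"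
  unfolding sinkhorn_step_def by (intro recip1_positive recip2_positive)

text \<open>The averaging over the first factor supplies the contraction; for the second,
  monotonicity suffices. The first reciprocal turns \<open>[lo, hi]\<close> into
  \<open>[1 / hi, 1 / lo]\<close> and the second turns it back.\<close>

lemma sinkhorn_step_contraction:
  assumes f: "bounded_positive M1 f" and g: "bounded_positive M1 g" and "0 < \<alpha>"
    and fg: "\<And>x. \<alpha> * f x \<le> g x \<and> g x \<le> \<beta> * f x"
  shows "\<exists>lo hi. \<alpha> \<le> lo \<and> hi - lo \<le> (1 - (m / K)\<^sup>2) * (\<beta> - \<alpha>) \<and>
    (\<forall>x. lo * sinkhorn_step f x \<le> sinkhorn_step g x \<and> sinkhorn_step g x \<le> hi * sinkhorn_step f x)"
proof -
  obtain lo hi where *: "\<alpha> \<le> lo" "lo \<le> hi" "hi - lo \<le> (1 - (m / K)\<^sup>2) * (\<beta> - \<alpha>)"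
    "\<And>y. lo * (\<integral>x. k (x, y) * f x \<partial>M1) \<le> (\<integral>x. k (x, y) * g x \<partial>M1) \<and>
         (\<integral>x. k (x, y) * g x \<partial>M1) \<le> hi * (\<integral>x. k (x, y) * f x \<partial>M1)"
    using K1.kernel_average_contraction[OF f g fg] by blast
  have pos: "0 < lo" "0 < hi" using \<open>0 < \<alpha>\<close> * by auto
  have "1 / hi * recip1 f y \<le> recip1 g y \<and> recip1 g y \<le> 1 / lo * recip1 f y" for y
    using K1.kernel_recip_ratio[OF f g pos(1) conjunct1[OF *(4)[of y]] conjunct2[OF *(4)[of y]]] by blast
  from K2.kernel_integral_ratio[OF recip1_positive[OF f] recip1_positive[OF g] this]
  have "lo * sinkhorn_step f x \<le> sinkhorn_step g x \<and> sinkhorn_step g x \<le> hi * sinkhorn_step f x" for x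
    unfolding sinkhorn_step_def
    using K2.kernel_recip_ratio[OF recip1_positive[OF f] recip1_positive[OF g], of "1 / hi" x "1 / lo"] pos
    by simp
  with *(1,3) show ?thesis by blast
qed

text \<open>Both \<open>f(x) k(x,y) recip1 f (y)\<close> and \<open>sinkhorn_step f (x) k(x,y) recip1 f (y)\<close> have total
  mass one, so the ratio of consecutive iterates cannot stay on one side of 1.\<close>

lemma integral_step_ratio:
  assumes f: "bounded_positive M1 f"
  shows "integrable M1 (\<lambda>x. f x / sinkhorn_step f x)" and "(\<integral>x. f x / sinkhorn_step f x \<partial>M1) = 1"
proof -
  obtain l u where fm [measurable]: "f \<in> borel_measurable M1" and l: "0 < l" and
    lu: "\<And>x. l \<le> f x \<and> f x \<le> u" using f unfolding bounded_positive_def by blast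
  note b = recip1_positive[OF f]
  obtain l' u' where bm [measurable]: "recip1 f \<in> borel_measurable M2" and l': "0 < l'" and
    lu': "\<And>x. l' \<le> recip1 f x \<and> recip1 f x \<le> u'" using b unfolding bounded_positive_def by blast
  \<comment> \<open>Integrated over \<open>y\<close>, \<open>J\<close> yields
    \<open>f / sinkhorn_step f\<close>; integrated over \<open>x\<close>, the constant 1. Fubini
    equates the totals.\<close>
  define J where "J = (\<lambda>x y. f x * (k (x, y) * recip1 f y))"
  have J: "integrable (M1 \<Otimes>\<^sub>M M2) (case_prod J)"
  proof (rule integrable_const_bound[where B = "u * (K * u')"])
    have "\<bar>J x y\<bar> \<le> u * (K * u')" for x y
      using lu[of x] lu'[of y] K1.kernel_pos[of x y] k_le[of "(x, y)"] l l'
      unfolding J_def abs_mult by (intro mult_mono mult_nonneg_nonneg) auto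
    then show "AE z in M1 \<Otimes>\<^sub>M M2. norm (case_prod J z) \<le> u * (K * u')" by auto
    show "case_prod J \<in> borel_measurable (M1 \<Otimes>\<^sub>M M2)"
      unfolding J_def by measurable
  qed
  \<comment> \<open>The reciprocal of \<open>sinkhorn_step f x\<close> is the very integral inverted
    by \<open>recip2\<close>.\<close>
  have eq: "f x / sinkhorn_step f x = (\<integral>y. J x y \<partial>M2)" for x
    unfolding sinkhorn_step_def kernel_recip_def[of M2] J_def by simp
  show "integrable M1 (\<lambda>x. f x / sinkhorn_step f x)"
    unfolding eq using integrable_fst[OF J] .
  have "(\<integral>x. J x y \<partial>M1) = 1" for y
  proof -
    have "(\<integral>x. J x y \<partial>M1) = recip1 f y * (\<integral>x. k (x, y) * f x \<partial>M1)"
      unfolding J_def by (subst Bochner_Integration.integral_mult_right_zero[symmetric]) (simp add: ac_simps)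
    also have "\<dots> = 1"
      using K1.kernel_integral_pos[OF f, of y] unfolding kernel_recip_def by simp
    finally show ?thesis .
  qed
  then show "(\<integral>x. f x / sinkhorn_step f x \<partial>M1) = 1"
    unfolding eq Fubini_integral[OF J, symmetric] by (simp add: M2.prob_space)
qed

text \<open>The quotient \<open>f / sinkhorn_step f\<close> lies in
  \<open>[1 / \<beta>, 1 / \<alpha>]\<close> and has mean 1 under a probability measure.\<close>

lemma step_ratio_around_one:
  assumes f: "bounded_positive M1 f" and "0 < \<alpha>"
    and "\<And>x. \<alpha> * f x \<le> sinkhorn_step f x \<and> sinkhorn_step f x \<le> \<beta> * f x"
  shows "\<alpha> \<le> 1" and "1 \<le> \<beta>"
proof -
  have pos: "0 < f x" "0 < sinkhorn_step f x" for x
    using f sinkhorn_step_positive[OF f] unfolding bounded_positive_def by (meson less_le_trans)+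
  have "0 < \<beta> * f undefined" using assms(3) pos(2) less_le_trans by blast
  then have "0 < \<beta>" using pos(1)[of undefined] by (simp add: zero_less_mult_iff)
  have "f x / sinkhorn_step f x \<le> 1 / \<alpha>" "1 / \<beta> \<le> f x / sinkhorn_step f x" for x
    using assms(3)[of x] pos[of x] \<open>0 < \<alpha>\<close> \<open>0 < \<beta>\<close> by (simp_all add: field_simps)
  then have "1 \<le> 1 / \<alpha>" "1 / \<beta> \<le> 1"
    using integral_mono[OF integral_step_ratio(1)[OF f], of "\<lambda>_. 1 / \<alpha>"]
      integral_mono[OF _ integral_step_ratio(1)[OF f], of "\<lambda>_. 1 / \<beta>"]
      integral_step_ratio(2)[OF f] by (simp_all add: M1.prob_space)
  then show "\<alpha> \<le> 1" "1 \<le> \<beta>" using \<open>0 < \<alpha>\<close> \<open>0 < \<beta>\<close> by (simp_all add: field_simps)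
qed

section \<open>Geometric convergence of the iterates\<close>

definition iter_a :: "nat \<Rightarrow> 'a \<Rightarrow> real" where
  "iter_a n = (sinkhorn_step ^^ n) (\<lambda>_. 1)"

lemma iter_a_0: "iter_a 0 = (\<lambda>_. 1)"
  and iter_a_Suc: "iter_a (Suc n) = sinkhorn_step (iter_a n)"
  by (simp_all add: iter_a_def)

lemma iter_a_positive: "bounded_positive M1 (iter_a n)"
proof (induction n)
  case 0
  show ?case unfolding iter_a_0 bounded_positive_def
    by (auto intro!: exI[of _ "1::real"])
qed (simp add: iter_a_Suc sinkhorn_step_positive)

lemma iter_a_pos: "0 < iter_a n x"
  using iter_a_positive[of n] unfolding bounded_positive_def by (meson less_le_trans)

lemma iter_a_measurable [measurable]: "iter_a n \<in> borel_measurable M1"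
  using iter_a_positive unfolding bounded_positive_def by blast

lemma contraction_factor: "0 \<le> 1 - (m / K)\<^sup>2" "1 - (m / K)\<^sup>2 < 1"
  using m_pos K1.K_pos K1.m_le_K by (auto simp: power_le_one)

text \<open>Iterated contraction. The lower ends \<alpha> never decrease along the induction, so one
  positive \<open>\<alpha>0\<close> bounds them all.\<close>

lemma iter_a_ratio:
  "\<exists>\<alpha>0 C. 0 < \<alpha>0 \<and> 0 \<le> C \<and>
    (\<forall>n. \<exists>\<alpha> \<beta>. \<alpha>0 \<le> \<alpha> \<and> \<beta> - \<alpha> \<le> C * (1 - (m / K)\<^sup>2) ^ n \<and>
       (\<forall>x. \<alpha> * iter_a n x \<le> iter_a (Suc n) x \<and> iter_a (Suc n) x \<le> \<beta> * iter_a n x))"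
proof -
  \<comment> \<open>As \<open>iter_a 0\<close> is constantly 1, bounds on \<open>iter_a 1\<close>
    are bounds on the first ratio, whence \<open>\<alpha>0 = l\<close> and
    \<open>C = u - l\<close>.\<close>
  obtain l u where l: "0 < l" and lu: "\<And>x. l \<le> iter_a 1 x \<and> iter_a 1 x \<le> u"
    using iter_a_positive[of 1] unfolding bounded_positive_def by blast
  have "l \<le> u" using lu order_trans by blast
  have "\<exists>\<alpha> \<beta>. l \<le> \<alpha> \<and> \<beta> - \<alpha> \<le> (u - l) * (1 - (m / K)\<^sup>2) ^ n \<and>
       (\<forall>x. \<alpha> * iter_a n x \<le> iter_a (Suc n) x \<and> iter_a (Suc n) x \<le> \<beta> * iter_a n x)" for n
  proof (induction n)
    case 0
    show ?case using lu by (intro exI[of _ l] exI[of _ u]) (auto simp: iter_a_0)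
  next
    case (Suc n)
    then obtain \<alpha> \<beta> where *: "l \<le> \<alpha>" "\<beta> - \<alpha> \<le> (u - l) * (1 - (m / K)\<^sup>2) ^ n"
      "\<And>x. \<alpha> * iter_a n x \<le> iter_a (Suc n) x \<and> iter_a (Suc n) x \<le> \<beta> * iter_a n x" by blast
    obtain lo hi where **: "\<alpha> \<le> lo" "hi - lo \<le> (1 - (m / K)\<^sup>2) * (\<beta> - \<alpha>)"
      "\<And>x. lo * iter_a (Suc n) x \<le> iter_a (Suc (Suc n)) x \<and> iter_a (Suc (Suc n)) x \<le> hi * iter_a (Suc n) x"
      using sinkhorn_step_contraction[OF iter_a_positive[of n] iter_a_positive[of "Suc n"]
          less_le_trans[OF l *(1)] *(3), folded iter_a_Suc] by blast
    have "hi - lo \<le> (u - l) * (1 - (m / K)\<^sup>2) ^ Suc n"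
      using **(2) mult_left_mono[OF *(2) contraction_factor(1)] by (simp add: ac_simps)
    with ** *(1) show ?case by (meson order_trans)
  qed
  with l \<open>l \<le> u\<close> show ?thesis by (intro exI[of _ l] exI[of _ "u - l"]) simp
qed

text \<open>Both the ratio \<open>r\<close> and 1 lie in \<open>[\<alpha>, \<beta>]\<close>, so
  \<open>ln r\<close> is controlled by the width of the interval. Without 1 inside, a shrinking
  width would not force \<open>ln r\<close> to 0.\<close>

lemma iter_a_log_increment:
  "\<exists>C\<ge>0. \<forall>n x. \<bar>ln (iter_a (Suc n) x) - ln (iter_a n x)\<bar> \<le> C * (1 - (m / K)\<^sup>2) ^ n"
proof -
  obtain \<alpha>0 C where C: "0 < \<alpha>0" "0 \<le> C"
    "\<And>n. \<exists>\<alpha> \<beta>. \<alpha>0 \<le> \<alpha> \<and> \<beta> - \<alpha> \<le> C * (1 - (m / K)\<^sup>2) ^ n \<and>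
       (\<forall>x. \<alpha> * iter_a n x \<le> iter_a (Suc n) x \<and> iter_a (Suc n) x \<le> \<beta> * iter_a n x)"
    using iter_a_ratio by blast
  have "\<bar>ln (iter_a (Suc n) x) - ln (iter_a n x)\<bar> \<le> C / \<alpha>0 * (1 - (m / K)\<^sup>2) ^ n" for n x
  proof -
    obtain \<alpha> \<beta> where *: "\<alpha>0 \<le> \<alpha>" "\<beta> - \<alpha> \<le> C * (1 - (m / K)\<^sup>2) ^ n"
      "\<And>x. \<alpha> * iter_a n x \<le> iter_a (Suc n) x \<and> iter_a (Suc n) x \<le> \<beta> * iter_a n x"
      using C(3)[of n] by blast
    have \<alpha>: "0 < \<alpha>" using * C by simp
    have one: "\<alpha> \<le> 1" "1 \<le> \<beta>"
      using step_ratio_around_one[OF iter_a_positive \<alpha>] *(3) unfolding iter_a_Suc by blast+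
    define r where "r = iter_a (Suc n) x / iter_a n x"
    have r: "\<alpha> \<le> r" "r \<le> \<beta>" using *(3)[of x] iter_a_pos[of n x] by (simp_all add: r_def field_simps)
    have "ln r = ln (iter_a (Suc n) x) - ln (iter_a n x)"
      unfolding r_def using iter_a_pos[of n x] iter_a_pos[of "Suc n" x] by (simp add: ln_div)
    moreover have "\<bar>ln r\<bar> \<le> (\<beta> - \<alpha>) / \<alpha>"
    proof -
      \<comment> \<open>Above, \<open>ln \<beta> \<le> \<beta> - 1\<close> is used; below,
        \<open>ln (1 / \<alpha>) \<le> 1 / \<alpha> - 1\<close>, which is where the divisor \<alpha>
        comes from.\<close>
      have "ln r \<le> ln \<beta>" "ln \<alpha> \<le> ln r" using r \<alpha> by (auto intro: ln_mono)
      moreover have "ln \<beta> \<le> \<beta> - 1" using ln_le_minus_one[of \<beta>] one by simp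
      moreover have "\<beta> - 1 \<le> \<beta> - \<alpha>" using one by simp
      moreover have "\<beta> - \<alpha> \<le> (\<beta> - \<alpha>) / \<alpha>"
      proof -
        have "(\<beta> - \<alpha>) * \<alpha> \<le> \<beta> - \<alpha>" using one mult_left_le[of \<alpha> "\<beta> - \<alpha>"] by simp
        then show ?thesis using \<alpha> by (simp add: pos_le_divide_eq)
      qed
      moreover have "- ln \<alpha> \<le> (\<beta> - \<alpha>) / \<alpha>"
      proof -
        have "- ln \<alpha> = ln (1 / \<alpha>)" using \<alpha> by (simp add: ln_div)
        also have "\<dots> \<le> 1 / \<alpha> - 1" using \<alpha> by (intro ln_le_minus_one) simp
        also have "\<dots> = (1 - \<alpha>) / \<alpha>" using \<alpha> by (simp add: field_simps)
        also have "\<dots> \<le> (\<beta> - \<alpha>) / \<alpha>" using \<alpha> one by (intro divide_right_mono) auto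
        finally show ?thesis .
      qed
      ultimately show ?thesis by linarith
    qed
    moreover have "(\<beta> - \<alpha>) / \<alpha> \<le> (C * (1 - (m / K)\<^sup>2) ^ n) / \<alpha>0"
      using * one C \<alpha> contraction_factor(1) by (intro frac_le) auto
    ultimately show ?thesis by simp
  qed
  with C show ?thesis by (intro exI[of _ "C / \<alpha>0"]) simp
qed

text \<open>The increments of the logarithms are dominated by a geometric series, so the logarithms
  converge and are uniformly bounded; exponentiating gives a positive lower bound as well as an
  upper one.\<close>

lemma iter_a_converges:
  "\<exists>l u a. 0 < l \<and> (\<forall>n x. l \<le> iter_a n x \<and> iter_a n x \<le> u) \<and> (\<forall>x. (\<lambda>n. iter_a n x) \<longlonglongrightarrow> a x)"
proof -
  define q where "q = 1 - (m / K)\<^sup>2"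
  have q: "0 \<le> q" "q < 1" using contraction_factor by (auto simp: q_def)
  obtain C where C: "0 \<le> C" "\<And>n x. \<bar>ln (iter_a (Suc n) x) - ln (iter_a n x)\<bar> \<le> C * q ^ n"
    using iter_a_log_increment unfolding q_def by blast
  define d where "d = (\<lambda>x n. ln (iter_a (Suc n) x) - ln (iter_a n x))"
  have sm: "summable (\<lambda>n. C * q ^ n)" using q by (intro summable_mult summable_geometric) auto
  have d: "summable (\<lambda>n. d x n)" for x
    using C(2)[of _ x] by (intro summable_comparison_test'[OF sm, of 0]) (auto simp: d_def)
  \<comment> \<open>The telescoping sum starts from
    \<open>ln (iter_a 0 x) = ln 1 = 0\<close>.\<close>
  have tel: "(\<Sum>i<n. d x i) = ln (iter_a n x)" for n x
    unfolding d_def by (subst sum_lessThan_telescope) (simp add: iter_a_0)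
  have "\<bar>ln (iter_a n x)\<bar> \<le> C / (1 - q)" for n x
  proof -
    have "\<bar>ln (iter_a n x)\<bar> \<le> (\<Sum>i<n. \<bar>d x i\<bar>)" unfolding tel[symmetric] by (rule sum_abs)
    also have "\<dots> \<le> (\<Sum>i<n. C * q ^ i)" using C(2) by (intro sum_mono) (auto simp: d_def)
    also have "\<dots> \<le> (\<Sum>i. C * q ^ i)" using q C by (intro sum_le_suminf[OF sm]) auto
    also have "\<dots> = C / (1 - q)" using q by (simp add: suminf_mult suminf_geometric)
    finally show ?thesis .
  qed
  then have "exp (- (C / (1 - q))) \<le> iter_a n x \<and> iter_a n x \<le> exp (C / (1 - q))" for n x
    by (metis abs_le_D1 abs_le_D2 exp_le_cancel_iff exp_ln iter_a_pos minus_le_iff)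
  moreover have "(\<lambda>n. iter_a n x) \<longlonglongrightarrow> exp (\<Sum>i. d x i)" for x
  proof -
    have "(\<lambda>n. ln (iter_a n x)) \<longlonglongrightarrow> (\<Sum>i. d x i)"
      using summable_LIMSEQ[OF d, of x] unfolding tel .
    from tendsto_exp[OF this] show ?thesis by (simp add: iter_a_pos)
  qed
  ultimately show ?thesis
    by (intro exI[of _ "exp (- (C / (1 - q)))"] exI[of _ "exp (C / (1 - q))"] exI[of _ "\<lambda>x. exp (\<Sum>i. d x i)"]) simp
qed

text \<open>Continuity of \<open>kernel_recip\<close> along the iterates lets both half steps pass
  to the limit, so the equations between \<open>a\<close> and \<open>b\<close> hold at every
  point.\<close>

lemma sinkhorn_limit:
  "\<exists>a b B. bounded_positive M1 a \<and> bounded_positive M2 b \<and> a = recip2 b \<and> b = recip1 a \<and>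
     (\<forall>x. (\<lambda>n. iter_a n x) \<longlonglongrightarrow> a x) \<and> (\<forall>y. (\<lambda>n. recip1 (iter_a n) y) \<longlonglongrightarrow> b y) \<and>
     (\<forall>n x. \<bar>iter_a n x\<bar> \<le> B) \<and> (\<forall>n y. \<bar>recip1 (iter_a n) y\<bar> \<le> B)"
proof -
  obtain l u a where l: "0 < l" and lu: "\<And>n x. l \<le> iter_a n x \<and> iter_a n x \<le> u"
    and a: "\<And>x. (\<lambda>n. iter_a n x) \<longlonglongrightarrow> a x"
    using iter_a_converges by blast
  define b where "b = recip1 a"
  \<comment> \<open>The upper bound of the iterates yields the lower bound of their reciprocal
    averages, and conversely.\<close>
  define l' u' where "l' = 1 / (K * u)" and "u' = 1 / (m * l)"
  have "0 < u" using l lu[of 0 undefined] by linarith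
  then have l': "0 < l'" using K1.K_pos by (simp add: l'_def)
  have lu': "l' \<le> recip1 (iter_a n) y \<and> recip1 (iter_a n) y \<le> u'" for n y
    using K1.kernel_recip_bounds[OF iter_a_measurable l lu] by (simp add: l'_def u'_def)
  have b: "(\<lambda>n. recip1 (iter_a n) y) \<longlonglongrightarrow> b y" for y
    unfolding b_def by (rule K1.kernel_recip_tendsto[OF iter_a_measurable l lu a])
  have "(\<lambda>n. iter_a (Suc n) x) \<longlonglongrightarrow> recip2 b x" for x
    unfolding iter_a_Suc sinkhorn_step_def
    by (rule K2.kernel_recip_tendsto[OF recip1_measurable[OF iter_a_measurable] l' lu' b])
  then have ab: "a = recip2 b"
    by (intro ext LIMSEQ_unique[OF LIMSEQ_Suc[OF a]])
  have "a \<in> borel_measurable M1"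
    by (rule borel_measurable_LIMSEQ_real[OF a iter_a_measurable])
  moreover have "l \<le> a x \<and> a x \<le> u" for x
    using LIMSEQ_le_const[OF a[of x], of l] LIMSEQ_le_const2[OF a[of x], of u] lu by auto
  ultimately have pa: "bounded_positive M1 a"
    unfolding bounded_positive_def using l by blast
  moreover have "bounded_positive M2 b"
    unfolding b_def by (rule recip1_positive[OF pa])
  moreover have "\<bar>iter_a n x\<bar> \<le> max u u'" for n x
    using lu[of n x] l by auto
  moreover have "\<bar>recip1 (iter_a n) y\<bar> \<le> max u u'" for n y
    using lu'[of n y] l' by auto
  ultimately show ?thesis
    using a b ab b_def by blast
qed

end

section \<open>Lp convergence of uniformly bounded sequences\<close>

text \<open>Dominated convergence: on a probability space the constant \<open>(2 * B) powr p\<close>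
  is integrable.\<close>

lemma (in prob_space) tendsto_Lp_bounded:
  assumes [measurable]: "\<And>n. F n \<in> borel_measurable M" "f \<in> borel_measurable M"
    and bound: "\<And>n. AE x in M. \<bar>F n x\<bar> \<le> B" and lim: "AE x in M. (\<lambda>n. F n x) \<longlonglongrightarrow> f x" and p: "1 \<le> p"
  shows "tendsto_Lp p M F f"
proof -
  have "AE x in M. \<forall>n. \<bar>F n x\<bar> \<le> B" using bound by (simp add: AE_all_countable)
  with lim have fB: "AE x in M. \<bar>f x\<bar> \<le> B"
  proof eventually_elim
    case (elim x)
    then show ?case using LIMSEQ_le_const2[OF tendsto_rabs[OF elim(1)], of B] by blast
  qed
  have in_Lp: "in_Lp p M g" if [measurable]: "g \<in> borel_measurable M" and "AE x in M. \<bar>g x\<bar> \<le> B" for g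
  proof -
    have "AE x in M. norm (\<bar>g x\<bar> powr p) \<le> B powr p"
      using that(2) by eventually_elim (use p in \<open>auto intro!: powr_mono2\<close>)
    then show ?thesis
      unfolding in_Lp_def by (auto intro!: integrable_const_bound)
  qed
  have "(\<lambda>n. \<integral>x. \<bar>F n x - f x\<bar> powr p \<partial>M) \<longlonglongrightarrow> (\<integral>x. 0 \<partial>M)"
  proof (rule integral_dominated_convergence[where w = "\<lambda>_. (2 * B) powr p"])
    show "AE x in M. (\<lambda>n. \<bar>F n x - f x\<bar> powr p) \<longlonglongrightarrow> 0"
      using lim
    proof eventually_elim
      case (elim x)
      have "(\<lambda>n. \<bar>F n x - f x\<bar>) \<longlonglongrightarrow> 0"
        using tendsto_rabs[OF tendsto_diff[OF elim tendsto_const[of "f x"]]] by simp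
      \<comment> \<open>The base tends to 0, where \<open>powr\<close> is continuous because the
        exponent is positive.\<close>
      then have "(\<lambda>n. \<bar>F n x - f x\<bar> powr p) \<longlonglongrightarrow> 0 powr p"
        using p by (intro tendsto_powr') auto
      then show ?case by simp
    qed
    show "AE x in M. norm (\<bar>F n x - f x\<bar> powr p) \<le> (2 * B) powr p" for n
      using bound[of n] fB by eventually_elim (use p in \<open>auto intro!: powr_mono2\<close>)
  qed auto
  then have "(\<lambda>n. Lp_norm p M (\<lambda>x. F n x - f x)) \<longlonglongrightarrow> 0 powr (1 / p)"
    unfolding Lp_norm_def using p by (intro tendsto_powr') auto
  then show ?thesis
    unfolding tendsto_Lp_def using in_Lp bound fB by simp
qed

section \<open>The minimizer of the Schroedinger problem\<close>

lemma ext_integral_integrable: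
  assumes "integrable M f"
  shows "ext_integral M f = ereal (\<integral>x. f x \<partial>M)"
proof -
  have fin: "(\<integral>\<^sup>+x. ennreal (f x) \<partial>M) \<noteq> \<infinity>" "(\<integral>\<^sup>+x. ennreal (- f x) \<partial>M) \<noteq> \<infinity>"
    using assms by (auto simp: real_integrable_def)
  have "enn2ereal t = ereal (enn2real t)" if "t \<noteq> \<infinity>" for t
    using that by (cases t rule: ennreal_cases) (auto simp: enn2ereal_ennreal)
  then show ?thesis
    unfolding ext_integral_def real_lebesgue_integral_def[OF assms] using fin by simp
qed

context
  fixes M :: "'a measure" and \<phi> h :: "'a \<Rightarrow> real"
  assumes \<phi>_measurable [measurable]: "\<phi> \<in> borel_measurable M" and \<phi>_nonneg: "\<And>x. 0 \<le> \<phi> x"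
    and h: "integrable M h"
begin

text \<open>The negative part of \<phi> + h is dominated by |h| and has finite integral. The
  positive part has infinite integral, since \<phi> is at most that part plus |h|. So no difference
  of infinities arises.\<close>

lemma ext_integral_add_not_integrable:
  assumes "\<not> integrable M \<phi>"
  shows "ext_integral M (\<lambda>x. \<phi> x + h x) = \<infinity>"
proof -
  have [measurable]: "h \<in> borel_measurable M" using h by blast
  have hfin: "(\<integral>\<^sup>+x. ennreal \<bar>h x\<bar> \<partial>M) < \<infinity>"
    using h unfolding integrable_iff_bounded by simp
  have "(\<integral>\<^sup>+x. ennreal (- (\<phi> x + h x)) \<partial>M) \<le> (\<integral>\<^sup>+x. ennreal \<bar>h x\<bar> \<partial>M)"
  proof (intro nn_integral_mono ennreal_leI)
    show "- (\<phi> x + h x) \<le> \<bar>h x\<bar>" for x using \<phi>_nonneg[of x] by linarith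
  qed
  then have neg: "(\<integral>\<^sup>+x. ennreal (- (\<phi> x + h x)) \<partial>M) < \<infinity>"
    using hfin by (rule le_less_trans)
  have "(\<integral>\<^sup>+x. ennreal (\<phi> x) \<partial>M) = \<infinity>"
    using assms \<phi>_nonneg unfolding integrable_iff_bounded by (auto simp: less_top[symmetric])
  moreover have "(\<integral>\<^sup>+x. ennreal (\<phi> x) \<partial>M) \<le> (\<integral>\<^sup>+x. ennreal (\<phi> x + h x) + ennreal \<bar>h x\<bar> \<partial>M)"
  proof (rule nn_integral_mono)
    fix x
    \<comment> \<open>\<open>ennreal\<close> sends negative reals to 0, which \<open>max 0\<close>
      makes explicit.\<close>
    have "ennreal (\<phi> x) \<le> ennreal (max 0 (\<phi> x + h x) + \<bar>h x\<bar>)" by (intro ennreal_leI) linarith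
    also have "\<dots> = ennreal (\<phi> x + h x) + ennreal \<bar>h x\<bar>"
      by (subst ennreal_plus) (auto simp: ennreal_max_0)
    finally show "ennreal (\<phi> x) \<le> ennreal (\<phi> x + h x) + ennreal \<bar>h x\<bar>" .
  qed
  then have "(\<integral>\<^sup>+x. ennreal (\<phi> x) \<partial>M) \<le> (\<integral>\<^sup>+x. ennreal (\<phi> x + h x) \<partial>M) + (\<integral>\<^sup>+x. ennreal \<bar>h x\<bar> \<partial>M)"
    by (subst (asm) nn_integral_add) auto
  ultimately have "(\<integral>\<^sup>+x. ennreal (\<phi> x + h x) \<partial>M) = \<infinity>"
    using hfin by (auto simp: top_unique ennreal_add_eq_top)
  moreover obtain r where "(\<integral>\<^sup>+x. ennreal (- (\<phi> x + h x)) \<partial>M) = ennreal r" "0 \<le> r"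
    using neg by (cases "\<integral>\<^sup>+x. ennreal (- (\<phi> x + h x)) \<partial>M" rule: ennreal_cases) auto
  ultimately show ?thesis
    unfolding ext_integral_def by (simp add: enn2ereal_ennreal)
qed

lemma ext_integral_add_ge: "ereal (\<integral>x. h x \<partial>M) \<le> ext_integral M (\<lambda>x. \<phi> x + h x)"
proof (cases "integrable M \<phi>")
  case True
  then show ?thesis
    using ext_integral_integrable[OF Bochner_Integration.integrable_add[OF True h]] h \<phi>_nonneg by simp
qed (simp add: ext_integral_add_not_integrable)

text \<open>If \<phi> is not integrable, the left side is infinite and \<phi> cannot vanish almost
  everywhere, so both sides fail.\<close>

lemma ext_integral_add_eq_iff:
  "ext_integral M (\<lambda>x. \<phi> x + h x) = ereal (\<integral>x. h x \<partial>M) \<longleftrightarrow> (AE x in M. \<phi> x = 0)"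
proof (cases "integrable M \<phi>")
  case True
  then show ?thesis
    using ext_integral_integrable[OF Bochner_Integration.integrable_add[OF True h]] h
      integral_nonneg_eq_0_iff_AE[OF True] \<phi>_nonneg by simp
next
  case False
  have "\<not> (AE x in M. \<phi> x = 0)"
  proof
    assume "AE x in M. \<phi> x = 0"
    then have "integrable M \<phi> \<longleftrightarrow> integrable M (\<lambda>_. 0 :: real)"
      by (intro integrable_cong_AE) auto
    with False show False by simp
  qed
  with False show ?thesis by (simp add: ext_integral_add_not_integrable)
qed

end

section \<open>Pointwise entropy gap\<close>

text \<open>The Bregman divergence of \<open>s * ln s\<close>; at \<open>s = 0\<close> its value is
  \<open>t\<close>.\<close>

definition relative_entropy_gap :: "real \<Rightarrow> real \<Rightarrow> real" where
  "relative_entropy_gap s t = s * ln (s / t) - s + t"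

text \<open>This is ln v \<le> v - 1 at \<open>v = t / s\<close>, multiplied by
  \<open>s\<close>.\<close>

lemma relative_entropy_gap_nonneg:
  assumes "0 \<le> s" "0 < t"
  shows "0 \<le> relative_entropy_gap s t"
proof (cases "s = 0")
  case False
  then have s: "0 < s" using assms by simp
  have "s * ln (t / s) \<le> s * (t / s - 1)"
    using s assms by (intro mult_left_mono ln_le_minus_one) auto
  then show ?thesis
    using s assms by (simp add: relative_entropy_gap_def ln_div right_diff_distrib)
qed (use assms in \<open>simp add: relative_entropy_gap_def\<close>)

text \<open>Equality in ln v \<le> v - 1 forces v = 1; \<open>s = 0\<close> is excluded because the
  gap is then \<open>t > 0\<close>.\<close>

lemma relative_entropy_gap_eq_0_iff:
  assumes "0 \<le> s" "0 < t"
  shows "relative_entropy_gap s t = 0 \<longleftrightarrow> s = t"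
proof
  assume gap: "relative_entropy_gap s t = 0"
  then have s: "0 < s" using assms by (cases "s = 0") (auto simp: relative_entropy_gap_def)
  have "s * ln (t / s) = s * (t / s - 1)"
    using gap s assms by (simp add: relative_entropy_gap_def ln_div right_diff_distrib)
  then have "ln (t / s) = t / s - 1" using s by simp
  then have "t / s = 1" using s assms by (intro ln_eq_minus_one) auto
  then show "s = t" using s by simp
qed (use assms in \<open>simp add: relative_entropy_gap_def\<close>)

lemma ln_bounded_positive:
  assumes "bounded_positive N f"
  obtains B where "\<And>x. \<bar>ln (f x)\<bar> \<le> B"
proof -
  obtain l u where l: "0 < l" and lu: "\<And>x. l \<le> f x \<and> f x \<le> u"
    using assms unfolding bounded_positive_def by blast
  have "\<bar>ln (f x)\<bar> \<le> max \<bar>ln l\<bar> \<bar>ln u\<bar>" for x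
  proof -
    have "ln l \<le> ln (f x)" "ln (f x) \<le> ln u"
      using lu[of x] l by (auto intro!: ln_mono)
    then show ?thesis by linarith
  qed
  then show thesis by (rule that)
qed

section \<open>Coupling generated by a pair of potentials\<close>

text \<open>Any bounded positive fixed point of the two half steps is allowed, with the equations
  holding at every point.\<close>

locale schrodinger_potentials = sinkhorn M1 M2 "gibbs_kernel c \<epsilon>" m K
  for M1 :: "'a::polish_space measure" and M2 :: "'b::polish_space measure"
    and c :: "'a \<times> 'b \<Rightarrow> real" and \<epsilon> m K :: real +
  fixes a :: "'a \<Rightarrow> real" and b :: "'b \<Rightarrow> real"
  assumes sets1: "sets M1 = sets borel" and sets2: "sets M2 = sets borel" and \<epsilon>_pos: "0 < \<epsilon>"
    and a_positive: "bounded_positive M1 a" and b_positive: "bounded_positive M2 b"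
    and a_eq: "a = recip2 b" and b_eq: "b = recip1 a"
begin

abbreviation "k \<equiv> gibbs_kernel c \<epsilon>"

definition opt_density :: "'a \<times> 'b \<Rightarrow> real" where
  "opt_density = (\<lambda>(x, y). a x * b y * k (x, y))"

definition opt_coupling :: "('a \<times> 'b) measure" where
  "opt_coupling = density (M1 \<Otimes>\<^sub>M M2) (\<lambda>z. ennreal (opt_density z))"

text \<open>The minimal entropy: for the plan a b k, the logarithm of density over kernel is ln a +
  ln b, whose integral against a coupling depends on the marginals only.\<close>

definition opt_value :: real where
  "opt_value = (\<integral>x. ln (a x) \<partial>M1) + (\<integral>y. ln (b y) \<partial>M2)"

lemma a_measurable [measurable]: "a \<in> borel_measurable M1"
  and b_measurable [measurable]: "b \<in> borel_measurable M2"
  using a_positive b_positive unfolding bounded_positive_def by auto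

lemma a_pos: "0 < a x" and b_pos: "0 < b y"
  using a_positive b_positive unfolding bounded_positive_def by (meson less_le_trans)+

lemma sets_prod: "sets (M1 \<Otimes>\<^sub>M M2) = sets borel"
  unfolding sets_pair_measure_cong[OF sets1 sets2] borel_prod ..

lemma fst_snd_measurable [measurable]:
  "fst \<in> measurable (M1 \<Otimes>\<^sub>M M2) borel" "snd \<in> measurable (M1 \<Otimes>\<^sub>M M2) borel"
  using measurable_fst[of M1 M2] measurable_cong_sets[OF refl sets1]
    measurable_snd[of M1 M2] measurable_cong_sets[OF refl sets2] by blast+

lemma a_equation: "a x * (\<integral>y. k (x, y) * b y \<partial>M2) = 1"
  using K2.kernel_integral_pos[OF b_positive, of x] by (subst a_eq) (simp add: kernel_recip_def)

lemma b_equation: "b y * (\<integral>x. k (x, y) * a x \<partial>M1) = 1"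
  using K1.kernel_integral_pos[OF a_positive, of y] by (subst b_eq) (simp add: kernel_recip_def)

lemma solves: "solves_schrodinger_system c \<epsilon> M1 M2 a b"
  unfolding solves_schrodinger_system_def
  using a_measurable b_measurable a_pos b_pos a_equation b_equation
  by (simp add: measurable_cong_sets[OF sets1 refl] measurable_cong_sets[OF sets2 refl]
      less_imp_le mult.commute[of "a _" "k _"] mult.commute[of "b _" "k _"])

lemma opt_density_measurable [measurable]: "opt_density \<in> borel_measurable (M1 \<Otimes>\<^sub>M M2)"
  unfolding opt_density_def by measurable

lemma opt_density_pos: "0 < opt_density z"
  using a_pos b_pos K1.kernel_pos by (cases z) (auto simp: opt_density_def)

text \<open>The equation for \<open>a\<close> at \<open>x\<close> says that this slice has mass one,
  which makes \<open>M1\<close> the first marginal.\<close>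

lemma nn_integral_opt_density_snd: "(\<integral>\<^sup>+y. ennreal (opt_density (x, y)) \<partial>M2) = 1"
proof -
  have "opt_density (x, y) = a x * (k (x, y) * b y)" for y
    by (simp add: opt_density_def)
  then have "(\<integral>\<^sup>+y. ennreal (opt_density (x, y)) \<partial>M2) = ennreal (\<integral>y. a x * (k (x, y) * b y) \<partial>M2)"
    using opt_density_pos[of "(x, _)"] K2.integrable_kernel_positive[OF b_positive, of x]
    by (subst nn_integral_eq_integral) (auto simp: less_imp_le)
  then show ?thesis using a_equation by simp
qed

lemma nn_integral_opt_density_fst: "(\<integral>\<^sup>+x. ennreal (opt_density (x, y)) \<partial>M1) = 1"
proof -
  have "opt_density (x, y) = b y * (k (x, y) * a x)" for x
    by (simp add: opt_density_def)
  then have "(\<integral>\<^sup>+x. ennreal (opt_density (x, y)) \<partial>M1) = ennreal (\<integral>x. b y * (k (x, y) * a x) \<partial>M1)"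
    using opt_density_pos[of "(_, y)"] K1.integrable_kernel_positive[OF a_positive, of y]
    by (subst nn_integral_eq_integral) (auto simp: less_imp_le)
  then show ?thesis using b_equation by simp
qed

lemma distr_opt_fst: "distr opt_coupling borel fst = M1"
proof (rule measure_eqI)
  show "sets (distr opt_coupling borel fst) = sets M1" by (simp add: sets1)
  fix X assume "X \<in> sets (distr opt_coupling borel fst)"
  then have [measurable]: "X \<in> sets M1" "X \<in> sets borel" by (simp_all add: sets1)
  have "emeasure (distr opt_coupling borel fst) X = (\<integral>\<^sup>+z. indicator X z \<partial>distr opt_coupling borel fst)"
    by (simp add: sets1[symmetric])
  also have "\<dots> = (\<integral>\<^sup>+z. ennreal (opt_density z) * indicator X (fst z) \<partial>(M1 \<Otimes>\<^sub>M M2))"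
    unfolding opt_coupling_def by (subst nn_integral_distr) (auto simp: nn_integral_density sets1[symmetric])
  also have "\<dots> = (\<integral>\<^sup>+x. \<integral>\<^sup>+y. ennreal (opt_density (x, y)) * indicator X x \<partial>M2 \<partial>M1)"
    by (subst M2.nn_integral_fst[symmetric]) auto
  also have "\<dots> = (\<integral>\<^sup>+x. indicator X x \<partial>M1)"
    using nn_integral_opt_density_snd by (intro nn_integral_cong) (simp add: nn_integral_multc)
  finally show "emeasure (distr opt_coupling borel fst) X = emeasure M1 X" by simp
qed

lemma distr_opt_snd: "distr opt_coupling borel snd = M2"
proof (rule measure_eqI)
  show "sets (distr opt_coupling borel snd) = sets M2" by (simp add: sets2)
  fix X assume "X \<in> sets (distr opt_coupling borel snd)"
  then have [measurable]: "X \<in> sets M2" "X \<in> sets borel" by (simp_all add: sets2)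
  have "emeasure (distr opt_coupling borel snd) X = (\<integral>\<^sup>+z. indicator X z \<partial>distr opt_coupling borel snd)"
    by (simp add: sets2[symmetric])
  also have "\<dots> = (\<integral>\<^sup>+z. ennreal (opt_density z) * indicator X (snd z) \<partial>(M1 \<Otimes>\<^sub>M M2))"
    unfolding opt_coupling_def by (subst nn_integral_distr) (auto simp: nn_integral_density sets2[symmetric])
  also have "\<dots> = (\<integral>\<^sup>+y. \<integral>\<^sup>+x. ennreal (opt_density (x, y)) * indicator X y \<partial>M1 \<partial>M2)"
    by (subst nn_integral_snd[symmetric]) auto
  also have "\<dots> = (\<integral>\<^sup>+y. indicator X y \<partial>M2)"
    using nn_integral_opt_density_fst by (intro nn_integral_cong) (simp add: nn_integral_multc)
  finally show "emeasure (distr opt_coupling borel snd) X = emeasure M2 X" by simp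
qed

lemma prob_space_opt: "prob_space opt_coupling"
proof
  have "emeasure opt_coupling (space opt_coupling) = (\<integral>\<^sup>+z. ennreal (opt_density z) \<partial>(M1 \<Otimes>\<^sub>M M2))"
    unfolding opt_coupling_def by (subst emeasure_density) (auto intro!: nn_integral_cong)
  also have "\<dots> = (\<integral>\<^sup>+x. \<integral>\<^sup>+y. ennreal (opt_density (x, y)) \<partial>M2 \<partial>M1)"
    by (subst M2.nn_integral_fst[symmetric]) auto
  also have "\<dots> = 1" by (simp add: nn_integral_opt_density_snd M1.emeasure_space_1)
  finally show "emeasure opt_coupling (space opt_coupling) = 1" .
qed

lemma opt_coupling_in: "opt_coupling \<in> couplings M1 M2"
  unfolding couplings_def using prob_space_opt distr_opt_fst distr_opt_snd
  by (simp add: opt_coupling_def sets_prod)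

text \<open>This mass cancels the mass of a competitor in the entropy decomposition.\<close>

lemma integral_opt_density: "integrable (M1 \<Otimes>\<^sub>M M2) opt_density" "(\<integral>z. opt_density z \<partial>(M1 \<Otimes>\<^sub>M M2)) = 1"
proof -
  have "(\<integral>\<^sup>+z. ennreal (opt_density z) \<partial>(M1 \<Otimes>\<^sub>M M2)) = emeasure opt_coupling (space opt_coupling)"
    unfolding opt_coupling_def by (subst emeasure_density) (auto intro!: nn_integral_cong)
  then have *: "(\<integral>\<^sup>+z. ennreal (opt_density z) \<partial>(M1 \<Otimes>\<^sub>M M2)) = 1"
    using prob_space.emeasure_space_1[OF prob_space_opt] by simp
  show "integrable (M1 \<Otimes>\<^sub>M M2) opt_density"
    using * opt_density_pos by (intro integrableI_nonneg) (auto simp: less_imp_le)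
  show "(\<integral>z. opt_density z \<partial>(M1 \<Otimes>\<^sub>M M2)) = 1"
    using * opt_density_pos by (subst integral_eq_nn_integral) (auto simp: less_imp_le)
qed

lemma opt_absolutely_continuous: "absolutely_continuous (M1 \<Otimes>\<^sub>M M2) opt_coupling"
  unfolding opt_coupling_def by (intro absolutely_continuousI_density) measurable

lemma coupling_density_opt: "AE z in M1 \<Otimes>\<^sub>M M2. coupling_density M1 M2 opt_coupling z = opt_density z"
proof -
  have "AE z in M1 \<Otimes>\<^sub>M M2. ennreal (opt_density z) = RN_deriv (M1 \<Otimes>\<^sub>M M2) opt_coupling z"
    by (rule RN_deriv_unique) (auto simp: opt_coupling_def)
  then show ?thesis
  proof eventually_elim
    case (elim z)
    then show ?case using opt_density_pos[of z] by (simp add: coupling_density_def elim[symmetric])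
  qed
qed

section \<open>Entropy of an arbitrary coupling\<close>

lemma coupling_density_measurable [measurable]:
  "coupling_density M1 M2 \<gamma> \<in> borel_measurable (M1 \<Otimes>\<^sub>M M2)"
  unfolding coupling_density_def by measurable

lemma coupling_density_nonneg: "0 \<le> coupling_density M1 M2 \<gamma> z"
  by (simp add: coupling_density_def)

text \<open>The derivative of a sigma-finite measure is finite almost everywhere, so reading it as a
  real function loses no mass.\<close>

lemma density_coupling_density:
  assumes \<gamma>: "\<gamma> \<in> couplings M1 M2" and ac: "absolutely_continuous (M1 \<Otimes>\<^sub>M M2) \<gamma>"
  shows "density (M1 \<Otimes>\<^sub>M M2) (\<lambda>z. ennreal (coupling_density M1 M2 \<gamma> z)) = \<gamma>"
proof -
  have sets: "sets \<gamma> = sets (M1 \<Otimes>\<^sub>M M2)" and "prob_space \<gamma>"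
    using \<gamma> by (auto simp: couplings_def sets_prod)
  then have "sigma_finite_measure \<gamma>"
    by (simp add: prob_space_imp_sigma_finite)
  from RN_deriv_finite[OF this ac sets]
  have "AE z in M1 \<Otimes>\<^sub>M M2. ennreal (coupling_density M1 M2 \<gamma> z) = RN_deriv (M1 \<Otimes>\<^sub>M M2) \<gamma> z"
    by eventually_elim (simp add: coupling_density_def top.not_eq_extremum)
  then have "density (M1 \<Otimes>\<^sub>M M2) (\<lambda>z. ennreal (coupling_density M1 M2 \<gamma> z)) =
      density (M1 \<Otimes>\<^sub>M M2) (RN_deriv (M1 \<Otimes>\<^sub>M M2) \<gamma>)"
    by (intro density_cong) auto
  also have "\<dots> = \<gamma>" by (rule density_RN_deriv[OF ac sets])
  finally show ?thesis .
qed

text \<open>Each term depends on one coordinate, so its integral is computed under a prescribed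
  marginal; the logarithms are bounded, hence integrable.\<close>

lemma integral_ln_potentials:
  assumes \<gamma>: "\<gamma> \<in> couplings M1 M2"
  shows "integrable \<gamma> (\<lambda>z. ln (a (fst z)) + ln (b (snd z)))"
    and "(\<integral>z. ln (a (fst z)) + ln (b (snd z)) \<partial>\<gamma>) = opt_value"
proof -
  have sets: "sets \<gamma> = sets (M1 \<Otimes>\<^sub>M M2)" and "prob_space \<gamma>"
    and fst: "distr \<gamma> borel fst = M1" and snd: "distr \<gamma> borel snd = M2"
    using \<gamma> by (auto simp: couplings_def sets_prod)
  interpret \<gamma>: prob_space \<gamma> by fact
  have [measurable_cong]: "sets \<gamma> = sets (M1 \<Otimes>\<^sub>M M2)" by fact
  have [measurable]: "a \<in> borel_measurable borel" "b \<in> borel_measurable borel"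
    using a_measurable b_measurable
    by (simp_all add: measurable_cong_sets[OF sets1 refl] measurable_cong_sets[OF sets2 refl])
  have [measurable]: "fst \<in> measurable \<gamma> borel" "snd \<in> measurable \<gamma> borel"
    by measurable
  obtain A where A: "\<And>x. \<bar>ln (a x)\<bar> \<le> A" using ln_bounded_positive[OF a_positive] by blast
  obtain B where B: "\<And>x. \<bar>ln (b x)\<bar> \<le> B" using ln_bounded_positive[OF b_positive] by blast
  have int: "integrable \<gamma> (\<lambda>z. ln (a (fst z)))" "integrable \<gamma> (\<lambda>z. ln (b (snd z)))"
    using \<gamma>.integrable_const_bound[of "\<lambda>z. ln (a (fst z))" A]
      \<gamma>.integrable_const_bound[of "\<lambda>z. ln (b (snd z))" B] A B by auto
  then show "integrable \<gamma> (\<lambda>z. ln (a (fst z)) + ln (b (snd z)))" by simp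
  have "(\<integral>z. ln (a (fst z)) \<partial>\<gamma>) = (\<integral>x. ln (a x) \<partial>M1)"
    by (subst fst[symmetric], subst integral_distr) auto
  moreover have "(\<integral>z. ln (b (snd z)) \<partial>\<gamma>) = (\<integral>y. ln (b y) \<partial>M2)"
    by (subst snd[symmetric], subst integral_distr) auto
  ultimately show "(\<integral>z. ln (a (fst z)) + ln (b (snd z)) \<partial>\<gamma>) = opt_value"
    using int by (simp add: opt_value_def)
qed

text \<open>With g the optimal density, g / k = a b gives f ln (f / k) = f ln (f / g) + f (ln a + ln
  b). Completing the first term to the gap leaves f - g in \<open>h\<close>, and this difference of
  two probability densities integrates to 0.\<close>

lemma KL_gibbs_decomposition:
  assumes \<gamma>: "\<gamma> \<in> couplings M1 M2" and ac: "absolutely_continuous (M1 \<Otimes>\<^sub>M M2) \<gamma>"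
  obtains h where "integrable (M1 \<Otimes>\<^sub>M M2) h" "(\<integral>z. h z \<partial>(M1 \<Otimes>\<^sub>M M2)) = opt_value"
    "KL_gibbs c \<epsilon> M1 M2 \<gamma> =
       ext_integral (M1 \<Otimes>\<^sub>M M2) (\<lambda>z. relative_entropy_gap (coupling_density M1 M2 \<gamma> z) (opt_density z) + h z)"
proof
  define f where "f = coupling_density M1 M2 \<gamma>"
  define L where "L = (\<lambda>z. ln (a (fst z)) + ln (b (snd z)))"
  define h where "h = (\<lambda>z. f z - opt_density z + f z * L z)"
  have [measurable]: "f \<in> borel_measurable (M1 \<Otimes>\<^sub>M M2)" "L \<in> borel_measurable (M1 \<Otimes>\<^sub>M M2)"
    unfolding f_def L_def by measurable
  have f_nonneg: "0 \<le> f z" for z by (simp add: f_def coupling_density_nonneg)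
  have dens: "density (M1 \<Otimes>\<^sub>M M2) (\<lambda>z. ennreal (f z)) = \<gamma>"
    unfolding f_def by (rule density_coupling_density[OF \<gamma> ac])
  interpret \<gamma>: prob_space \<gamma> using \<gamma> by (simp add: couplings_def)
  \<comment> \<open>Integrals against \<gamma> become integrals weighted by \<open>f\<close> over
    the product measure.\<close>
  note transfer = integrable_density[of _ "M1 \<Otimes>\<^sub>M M2" f, unfolded dens]
    integral_density[of _ "M1 \<Otimes>\<^sub>M M2" f, unfolded dens]
  have f: "integrable (M1 \<Otimes>\<^sub>M M2) f" "(\<integral>z. f z \<partial>(M1 \<Otimes>\<^sub>M M2)) = 1"
    using transfer[of "\<lambda>_. 1::real"] f_nonneg by (simp_all add: \<gamma>.prob_space)
  have fL: "integrable (M1 \<Otimes>\<^sub>M M2) (\<lambda>z. f z * L z)" "(\<integral>z. f z * L z \<partial>(M1 \<Otimes>\<^sub>M M2)) = opt_value"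
    using transfer[of L] f_nonneg integral_ln_potentials[OF \<gamma>, folded L_def] by simp_all
  show "integrable (M1 \<Otimes>\<^sub>M M2) h" "(\<integral>z. h z \<partial>(M1 \<Otimes>\<^sub>M M2)) = opt_value"
    unfolding h_def using f fL integral_opt_density by simp_all
  have "f z * ln (f z / k z) = relative_entropy_gap (f z) (opt_density z) + h z" for z
  \<comment> \<open>Where \<open>f\<close> vanishes, the gap equals \<open>opt_density z\<close> and
    \<open>h z\<close> is its negative, matching 0 on the left.\<close>
  proof (cases "f z = 0")
    case False
    then have "0 < f z" using f_nonneg[of z] by simp
    then show ?thesis
      using a_pos[of "fst z"] b_pos[of "snd z"] K1.kernel_pos[of "fst z" "snd z"]
      by (cases z) (simp add: relative_entropy_gap_def h_def L_def opt_density_def ln_div ln_mult algebra_simps)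
  qed (simp add: relative_entropy_gap_def h_def)
  then show "KL_gibbs c \<epsilon> M1 M2 \<gamma> = ext_integral (M1 \<Otimes>\<^sub>M M2)
      (\<lambda>z. relative_entropy_gap (coupling_density M1 M2 \<gamma> z) (opt_density z) + h z)"
    unfolding KL_gibbs_def using ac by (simp add: f_def)
qed

lemma relative_entropy_gap_measurable:
  "(\<lambda>z. relative_entropy_gap (coupling_density M1 M2 \<gamma> z) (opt_density z)) \<in> borel_measurable (M1 \<Otimes>\<^sub>M M2)"
  unfolding relative_entropy_gap_def by measurable

lemma relative_entropy_gap_coupling_nonneg:
  "0 \<le> relative_entropy_gap (coupling_density M1 M2 \<gamma> z) (opt_density z)"
  by (intro relative_entropy_gap_nonneg coupling_density_nonneg opt_density_pos)

lemma KL_gibbs_ge_opt_value: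
  assumes \<gamma>: "\<gamma> \<in> couplings M1 M2"
  shows "ereal opt_value \<le> KL_gibbs c \<epsilon> M1 M2 \<gamma>"
proof (cases "absolutely_continuous (M1 \<Otimes>\<^sub>M M2) \<gamma>")
  case True
  obtain h where h: "integrable (M1 \<Otimes>\<^sub>M M2) h" "(\<integral>z. h z \<partial>(M1 \<Otimes>\<^sub>M M2)) = opt_value"
    "KL_gibbs c \<epsilon> M1 M2 \<gamma> = ext_integral (M1 \<Otimes>\<^sub>M M2)
      (\<lambda>z. relative_entropy_gap (coupling_density M1 M2 \<gamma> z) (opt_density z) + h z)"
    using KL_gibbs_decomposition[OF \<gamma> True] by blast
  show ?thesis
    using ext_integral_add_ge[OF relative_entropy_gap_measurable relative_entropy_gap_coupling_nonneg h(1)]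
    unfolding h .
qed (simp add: KL_gibbs_def)

lemma KL_gibbs_eq_opt_value_iff:
  assumes \<gamma>: "\<gamma> \<in> couplings M1 M2"
  shows "KL_gibbs c \<epsilon> M1 M2 \<gamma> = ereal opt_value \<longleftrightarrow> \<gamma> = opt_coupling"
proof (cases "absolutely_continuous (M1 \<Otimes>\<^sub>M M2) \<gamma>")
  case True
  obtain h where h: "integrable (M1 \<Otimes>\<^sub>M M2) h" "(\<integral>z. h z \<partial>(M1 \<Otimes>\<^sub>M M2)) = opt_value"
    "KL_gibbs c \<epsilon> M1 M2 \<gamma> = ext_integral (M1 \<Otimes>\<^sub>M M2)
      (\<lambda>z. relative_entropy_gap (coupling_density M1 M2 \<gamma> z) (opt_density z) + h z)"
    using KL_gibbs_decomposition[OF \<gamma> True] by blast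
  have "KL_gibbs c \<epsilon> M1 M2 \<gamma> = ereal opt_value \<longleftrightarrow>
      (AE z in M1 \<Otimes>\<^sub>M M2. relative_entropy_gap (coupling_density M1 M2 \<gamma> z) (opt_density z) = 0)"
    using ext_integral_add_eq_iff[OF relative_entropy_gap_measurable relative_entropy_gap_coupling_nonneg h(1)]
    unfolding h .
  also have "\<dots> \<longleftrightarrow> (AE z in M1 \<Otimes>\<^sub>M M2. coupling_density M1 M2 \<gamma> z = opt_density z)"
    by (simp add: relative_entropy_gap_eq_0_iff coupling_density_nonneg opt_density_pos)
  also have "\<dots> \<longleftrightarrow> \<gamma> = opt_coupling"
  proof
    assume "AE z in M1 \<Otimes>\<^sub>M M2. coupling_density M1 M2 \<gamma> z = opt_density z"
    then have "density (M1 \<Otimes>\<^sub>M M2) (\<lambda>z. ennreal (coupling_density M1 M2 \<gamma> z)) = opt_coupling"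
      unfolding opt_coupling_def by (intro density_cong) auto
    then show "\<gamma> = opt_coupling"
      using density_coupling_density[OF \<gamma> True] by simp
  qed (use coupling_density_opt in simp)
  finally show ?thesis .
next
  case False
  \<comment> \<open>Both sides are false: the entropy is infinite, and \<open>opt_coupling\<close>
    is absolutely continuous.\<close>
  then show ?thesis using opt_absolutely_continuous by (auto simp: KL_gibbs_def)
qed

lemma schrodinger_minimizer_iff: "schrodinger_minimizer c \<epsilon> M1 M2 \<gamma> \<longleftrightarrow> \<gamma> = opt_coupling"
proof -
  \<comment> \<open>Multiplication by the positive real \<epsilon> preserves the strict order also
    at infinite values.\<close>
  have less: "ereal \<epsilon> * s < ereal \<epsilon> * t \<longleftrightarrow> s < t" for s t
    using \<epsilon>_pos by (simp add: less_le_not_le ereal_mult_le_mult_iff)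
  have opt: "KL_gibbs c \<epsilon> M1 M2 opt_coupling = ereal opt_value"
    using KL_gibbs_eq_opt_value_iff[OF opt_coupling_in] by simp
  show ?thesis
    unfolding schrodinger_minimizer_def is_arg_min_def less
  proof safe
    assume "\<gamma> \<in> couplings M1 M2"
      and "\<nexists>\<gamma>'. \<gamma>' \<in> couplings M1 M2 \<and> KL_gibbs c \<epsilon> M1 M2 \<gamma>' < KL_gibbs c \<epsilon> M1 M2 \<gamma>"
    then show "\<gamma> = opt_coupling"
      using opt_coupling_in opt KL_gibbs_ge_opt_value KL_gibbs_eq_opt_value_iff
      by (metis antisym not_less)
  next
    fix \<gamma>' assume "\<gamma>' \<in> couplings M1 M2" "KL_gibbs c \<epsilon> M1 M2 \<gamma>' < KL_gibbs c \<epsilon> M1 M2 opt_coupling"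
    then show False using KL_gibbs_ge_opt_value[of \<gamma>'] opt by simp
  qed (rule opt_coupling_in)
qed

lemma schrodinger_opt_eq: "schrodinger_opt c \<epsilon> M1 M2 = opt_coupling"
  unfolding schrodinger_opt_def schrodinger_minimizer_iff by simp

end

section \<open>Identification with the IPFP sequences and passage to the limit\<close>

theorem theorem1p3:
  fixes \<rho>1 :: "'a::polish_space measure" and \<rho>2 :: "'b::polish_space measure"
    and c :: "'a \<times> 'b \<Rightarrow> real" and \<epsilon> :: real
  assumes "prob_space \<rho>1" and "sets \<rho>1 = sets borel"
    and "prob_space \<rho>2" and "sets \<rho>2 = sets borel"
    and "c \<in> borel_measurable borel" and "bounded (range c)"
    and "\<epsilon> > 0"
  shows "(\<exists>(l :: nat \<Rightarrow> real) a b.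
            (\<forall>n. l n > 0) \<and>
            solves_schrodinger_system c \<epsilon> \<rho>1 \<rho>2 a b \<and>
            (\<forall>p::real. 1 \<le> p \<longrightarrow>
               tendsto_Lp p \<rho>1 (\<lambda>n x. ipfp_a c \<epsilon> \<rho>1 \<rho>2 n x / l n) a \<and>
               tendsto_Lp p \<rho>2 (\<lambda>n y. l n * ipfp_b c \<epsilon> \<rho>1 \<rho>2 n y) b)) \<and>
         (\<exists>!\<gamma>. schrodinger_minimizer c \<epsilon> \<rho>1 \<rho>2 \<gamma>) \<and>
         (\<forall>p::real. 1 \<le> p \<longrightarrow>
            tendsto_Lp p (\<rho>1 \<Otimes>\<^sub>M \<rho>2)
              (\<lambda>n (x, y). ipfp_a c \<epsilon> \<rho>1 \<rho>2 n x * ipfp_b c \<epsilon> \<rho>1 \<rho>2 n y * gibbs_kernel c \<epsilon> (x, y))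
              (coupling_density \<rho>1 \<rho>2 (schrodinger_opt c \<epsilon> \<rho>1 \<rho>2)))"
proof -
  obtain C where C: "\<And>z. \<bar>c z\<bar> \<le> C"
    using assms(6) unfolding bounded_iff by auto
  interpret \<rho>1: prob_space \<rho>1 by fact
  interpret \<rho>2: prob_space \<rho>2 by fact
  have prod: "sets (\<rho>1 \<Otimes>\<^sub>M \<rho>2) = sets borel"
    unfolding sets_pair_measure_cong[OF assms(2,4)] borel_prod ..
  interpret sinkhorn \<rho>1 \<rho>2 "gibbs_kernel c \<epsilon>" "exp (- C / \<epsilon>)" "exp (C / \<epsilon>)"
  proof
    show "space \<rho>1 = UNIV" "space \<rho>2 = UNIV"
      using assms(2,4)[THEN sets_eq_imp_space_eq] by auto
    have [measurable]: "c \<in> borel_measurable (\<rho>1 \<Otimes>\<^sub>M \<rho>2)"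
      using assms(5) by (simp add: measurable_cong_sets[OF prod refl])
    show "gibbs_kernel c \<epsilon> \<in> borel_measurable (\<rho>1 \<Otimes>\<^sub>M \<rho>2)"
      unfolding gibbs_kernel_def by measurable
    fix z
    show "exp (- C / \<epsilon>) \<le> gibbs_kernel c \<epsilon> z" "gibbs_kernel c \<epsilon> z \<le> exp (C / \<epsilon>)"
      using C[of z] assms(7) unfolding gibbs_kernel_def exp_le_cancel_iff
      by - (rule divide_right_mono; linarith)+
  qed simp
  obtain a b B where ab: "bounded_positive \<rho>1 a" "bounded_positive \<rho>2 b" "a = recip2 b" "b = recip1 a"
    and lim_a: "\<And>x. (\<lambda>n. iter_a n x) \<longlonglongrightarrow> a x"
    and lim_b: "\<And>y. (\<lambda>n. recip1 (iter_a n) y) \<longlonglongrightarrow> b y"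
    and B: "\<And>n x. \<bar>iter_a n x\<bar> \<le> B" "\<And>n y. \<bar>recip1 (iter_a n) y\<bar> \<le> B"
    using sinkhorn_limit by blast
  interpret schrodinger_potentials \<rho>1 \<rho>2 c \<epsilon> "exp (- C / \<epsilon>)" "exp (C / \<epsilon>)" a b
    by unfold_locales (rule assms ab)+
  let ?a = "ipfp_a c \<epsilon> \<rho>1 \<rho>2" and ?b = "ipfp_b c \<epsilon> \<rho>1 \<rho>2"
  have a: "?a n = iter_a n" for n
    by (induction n) (auto simp: iter_a_0 iter_a_Suc sinkhorn_step_def kernel_recip_def)
  \<comment> \<open>The index is shifted: b^(n+1) is computed from a^n. The start b^0 = 1 does not
    arise this way and is treated apart.\<close>
  have b: "?b (Suc n) = recip1 (iter_a n)" for n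
    by (auto simp: a kernel_recip_def)
  have b0: "?b 0 = (\<lambda>_. 1)" by auto
  have am: "?a n \<in> borel_measurable \<rho>1" for n unfolding a by measurable
  have bm: "?b n \<in> borel_measurable \<rho>2" for n
    by (cases n) (simp_all add: b b0 del: ipfp_b.simps)
  note [measurable] = am bm
  \<comment> \<open>As \<open>iter_a 0\<close> is constantly 1, \<open>B\<close> also bounds
    b^0.\<close>
  have "B \<ge> 1" using B(1)[of 0 undefined] by (simp add: iter_a_0)
  then have Bb: "\<bar>?b n y\<bar> \<le> B" for n y
    using B(2) by (cases n) (simp_all add: b b0 del: ipfp_b.simps)
  have Ba: "\<bar>?a n x\<bar> \<le> B" for n x using B(1) by (simp add: a)
  have la: "(\<lambda>n. ?a n x) \<longlonglongrightarrow> a x" for x using lim_a by (simp add: a)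
  have "(\<lambda>n. ?b (Suc n) y) \<longlonglongrightarrow> b y" for y unfolding b by (rule lim_b)
  then have lb: "(\<lambda>n. ?b n y) \<longlonglongrightarrow> b y" for y by (rule LIMSEQ_imp_Suc)
  have potentials: "tendsto_Lp p \<rho>1 ?a a" "tendsto_Lp p \<rho>2 ?b b" if "1 \<le> p" for p
    using that Ba Bb la lb
    by (auto intro!: \<rho>1.tendsto_Lp_bounded[where B = B] \<rho>2.tendsto_Lp_bounded[where B = B])
  have plans: "tendsto_Lp p (\<rho>1 \<Otimes>\<^sub>M \<rho>2) (\<lambda>n (x, y). ?a n x * ?b n y * gibbs_kernel c \<epsilon> (x, y))
      (coupling_density \<rho>1 \<rho>2 (schrodinger_opt c \<epsilon> \<rho>1 \<rho>2))" if "1 \<le> p" for p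
  \<comment> \<open>This is applied on the product probability space; the bound multiplies those of
    the three factors.\<close>
  proof (rule tendsto_Lp_bounded[where B = "B * B * exp (C / \<epsilon>)"])
    have "\<bar>?a n x * ?b n y * gibbs_kernel c \<epsilon> (x, y)\<bar> \<le> B * B * exp (C / \<epsilon>)" for n x y
      unfolding abs_mult using Ba[of n x] Bb[of n y] k_le[of "(x, y)"] K1.kernel_pos[of x y]
      by (intro mult_mono) auto
    then show "AE z in \<rho>1 \<Otimes>\<^sub>M \<rho>2. \<bar>case z of (x, y) \<Rightarrow> ?a n x * ?b n y * gibbs_kernel c \<epsilon> (x, y)\<bar>
        \<le> B * B * exp (C / \<epsilon>)" for n by auto
    have lim: "(\<lambda>n. case z of (x, y) \<Rightarrow> ?a n x * ?b n y * gibbs_kernel c \<epsilon> (x, y)) \<longlonglongrightarrow> opt_density z" for z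
      using la lb by (cases z) (auto simp: opt_density_def intro!: tendsto_intros)
    show "AE z in \<rho>1 \<Otimes>\<^sub>M \<rho>2. (\<lambda>n. case z of (x, y) \<Rightarrow> ?a n x * ?b n y * gibbs_kernel c \<epsilon> (x, y))
        \<longlonglongrightarrow> coupling_density \<rho>1 \<rho>2 (schrodinger_opt c \<epsilon> \<rho>1 \<rho>2) z"
      \<comment> \<open>The density of the minimizer is determined only up to null sets, hence a
        limit almost everywhere.\<close>
      unfolding schrodinger_opt_eq using coupling_density_opt by eventually_elim (simp only: lim)
  qed (use that in measurable)
  have "\<exists>(l :: nat \<Rightarrow> real) a b. (\<forall>n. l n > 0) \<and> solves_schrodinger_system c \<epsilon> \<rho>1 \<rho>2 a b \<and>
      (\<forall>p::real. 1 \<le> p \<longrightarrow> tendsto_Lp p \<rho>1 (\<lambda>n x. ?a n x / l n) a \<and>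
         tendsto_Lp p \<rho>2 (\<lambda>n y. l n * ?b n y) b)"
    using solves potentials by (intro exI[of _ "\<lambda>_. 1"] exI[of _ a] exI[of _ b]) simp
  then show ?thesis
    using plans by (simp add: schrodinger_minimizer_iff)
qed

end
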